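(* Let $A$ be a (possibly unbounded) scalar type spectral operator in a complex Banach space $(X,\|\cdot\|)$ with spectral measure $E_A(\cdot)$. Every weak solution of the equation $y'(t)=Ay(t)$, $t\in\mathbb{R}$, is strongly infinite differentiable on $\mathbb{R}$ (i.e., belongs to $C^\infty(\mathbb{R},X)$) if and only if there exist $b_+>0$ and $b_->0$ such that the set $\sigma(A)\setminus \mathscr{L}_{b_-,b_+}$ is bounded, where $$\mathscr{L}_{b_-,b_+}:=\left\{\lambda\in\mathbb{C}\ \middle|\ \operatorname{Re}\lambda\le\min\left(0,-b_-\ln|\operatorname{Im}\lambda|\right)\ \text{or}\ \operatorname{Re}\lambda\ge\max\left(0,b_+\ln|\operatorname{Im}\lambda|\right)\right\}.$$
   Context: Scalar type spectral operator: a densely defined closed linear operator $A$ in a complex Banach space $X$ for which there is a spectral measure (resolution of the identity) $E_A(\cdot)$, i.e., a map assigning to each Borel set $\delta\subseteq\mathbb{C}$ a bounded projection operator $E_A(\delta)$ on $X$ with $E_A(\emptyset)=0$, $E_A(\mathbb{C})=I$ (the identity operator), $E_A(\delta)E_A(\sigma)=E_A(\delta\cap\sigma)$, strongly $\sigma$-additive, with the spectrum $\sigma(A)$ as its support, such that $A=\int_{\sigma(A)}\lambda\,dE_A(\lambda)$, meaning that $D(A)=\{f\in X: \lim_{n\to\infty}\int_{\{|\lambda|\le n\}}\lambda\,dE_A(\lambda)f \text{ exists in } X\}$ and $Af$ is this limit. In general, the integral of a bounded Borel function with respect to $E_A$ is the operator-norm limit of integrals of simple functions. Weak solution: a strongly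 (i.e., norm) continuous function $y:\mathbb{R}\to X$ is a weak solution of $y'(t)=Ay(t)$, $t\in\mathbb{R}$, if for every $g^*\in D(A^* )$, $\frac{d}{dt}\langle y(t),g^*\rangle=\langle y(t),A^*g^*\rangle$ for all $t\in\mathbb{R}$, where $A^*$ is the adjoint of $A$, $D(\cdot)$ is the domain of an operator, and $\langle\cdot,\cdot\rangle$ is the pairing between $X$ and its dual $X^*$. It need not be strongly differentiable. Strong differentiability means differentiability in the norm of $X$. Convention: $\ln 0=-\infty$, so that every real $\lambda$ belongs to $\mathscr{L}_{b_-,b_+}$. *)

theory Defs
  imports "HOL-Analysis.Analysis"
begin

text \<open>The distribution only has real normed spaces; a complex Banach space is a real one with a
  compatible complex scalar multiplication.\<close>

class complex_banach = banach +
  fixes scaleC :: "complex \<Rightarrow> 'a \<Rightarrow> 'a"  (infixr \<open>*\<^sub>C\<close> 75)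
  assumes scaleC_add_right: "a *\<^sub>C (x + y) = a *\<^sub>C x + a *\<^sub>C y"
    and scaleC_add_left: "(a + b) *\<^sub>C x = a *\<^sub>C x + b *\<^sub>C x"
    and scaleC_scaleC: "a *\<^sub>C (b *\<^sub>C x) = (a * b) *\<^sub>C x"
    and scaleR_scaleC: "r *\<^sub>R x = complex_of_real r *\<^sub>C x"
    and norm_scaleC: "norm (a *\<^sub>C x) = cmod a * norm x"

lemma vector_space_scaleC: "vector_space (scaleC :: complex \<Rightarrow> 'a::complex_banach \<Rightarrow> 'a)"
proof
  show "1 *\<^sub>C x = x" for x :: 'a
    using scaleR_scaleC[of 1 x] by simp
qed (simp_all add: scaleC_add_right scaleC_add_left scaleC_scaleC)

lemma bounded_linear_scaleC: "bounded_linear (scaleC c :: 'a::complex_banach \<Rightarrow> 'a)"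
proof (rule bounded_linear_intro[where K = "cmod c"])
  show "c *\<^sub>C (r *\<^sub>R x) = r *\<^sub>R c *\<^sub>C x" for r and x :: 'a
    by (simp add: scaleR_scaleC scaleC_scaleC mult.commute)
qed (simp_all add: scaleC_add_right norm_scaleC mult.commute)

text \<open>The library type of bounded operators only enforces real linearity.\<close>

definition complex_linear_op :: "('a::complex_banach \<Rightarrow>\<^sub>L 'a) \<Rightarrow> bool" where
  "complex_linear_op T \<longleftrightarrow> (\<forall>c x. T (c *\<^sub>C x) = c *\<^sub>C T x)"

definition dual_space :: "('a::complex_banach \<Rightarrow>\<^sub>L complex) set" where
  "dual_space = {g :: 'a \<Rightarrow>\<^sub>L complex. \<forall>c x. g (c *\<^sub>C x) = c * g x}"

definition scaleC_op :: "complex \<Rightarrow> ('a::complex_banach \<Rightarrow>\<^sub>L 'a)" where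
  "scaleC_op c = Blinfun (scaleC c)"

lemma scaleC_op_apply: "scaleC_op c x = c *\<^sub>C x"
  by (simp add: scaleC_op_def bounded_linear_Blinfun_apply bounded_linear_scaleC)

text \<open>An operator is given by its domain \<open>D\<close> and a total function \<open>A\<close> of which only
  the values on \<open>D\<close> matter.\<close>

definition linear_operator_on :: "'a::complex_banach set \<Rightarrow> ('a \<Rightarrow> 'a) \<Rightarrow> bool" where
  "linear_operator_on D A \<longleftrightarrow> module.subspace scaleC D \<and>
     (\<forall>x\<in>D. \<forall>y\<in>D. A (x + y) = A x + A y) \<and> (\<forall>c. \<forall>x\<in>D. A (c *\<^sub>C x) = c *\<^sub>C A x)"

definition closed_operator :: "'a::complex_banach set \<Rightarrow> ('a \<Rightarrow> 'a) \<Rightarrow> bool" where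
  "closed_operator D A \<longleftrightarrow> closed ((\<lambda>x. (x, A x)) ` D)"

definition densely_defined :: "'a::complex_banach set \<Rightarrow> bool" where
  "densely_defined D \<longleftrightarrow> closure D = UNIV"

definition resolvent_set :: "'a::complex_banach set \<Rightarrow> ('a \<Rightarrow> 'a) \<Rightarrow> complex set" where
  "resolvent_set D A = {l. \<exists>R :: 'a \<Rightarrow>\<^sub>L 'a.
     (\<forall>x\<in>D. R (A x - l *\<^sub>C x) = x) \<and> (\<forall>y. R y \<in> D \<and> A (R y) - l *\<^sub>C R y = y)}"

definition spectrum :: "'a::complex_banach set \<Rightarrow> ('a \<Rightarrow> 'a) \<Rightarrow> complex set" where
  "spectrum D A = - resolvent_set D A"

definition adjoint_domain :: "'a::complex_banach set \<Rightarrow> ('a \<Rightarrow> 'a) \<Rightarrow> ('a \<Rightarrow>\<^sub>L complex) set" where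
  "adjoint_domain D A = {g. g \<in> dual_space \<and> (\<exists>h\<in>dual_space. \<forall>x\<in>D. g (A x) = h x)}"

text \<open>The functional below is unique when \<open>D\<close> is dense.\<close>

definition adjoint_op ::
    "'a::complex_banach set \<Rightarrow> ('a \<Rightarrow> 'a) \<Rightarrow> ('a \<Rightarrow>\<^sub>L complex) \<Rightarrow> ('a \<Rightarrow>\<^sub>L complex)" where
  "adjoint_op D A g = (THE h. h \<in> dual_space \<and> (\<forall>x\<in>D. g (A x) = h x))"

text \<open>Only the values of \<open>E\<close> on Borel sets matter.\<close>

definition spectral_measure :: "(complex set \<Rightarrow> ('a::complex_banach \<Rightarrow>\<^sub>L 'a)) \<Rightarrow> bool" where
  "spectral_measure E \<longleftrightarrow>
     (\<forall>S\<in>sets borel. complex_linear_op (E S) \<and> E S o\<^sub>L E S = E S) \<and>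
     E {} = 0 \<and> E UNIV = id_blinfun \<and>
     (\<forall>S\<in>sets borel. \<forall>T\<in>sets borel. E S o\<^sub>L E T = E (S \<inter> T)) \<and>
     (\<forall>F :: nat \<Rightarrow> complex set. range F \<subseteq> sets borel \<longrightarrow> disjoint_family F \<longrightarrow>
        (\<forall>x. (\<lambda>i. E (F i) x) sums E (\<Union>i. F i) x))"

definition spectral_support :: "(complex set \<Rightarrow> ('a::complex_banach \<Rightarrow>\<^sub>L 'a)) \<Rightarrow> complex set" where
  "spectral_support E = {l. \<forall>U. open U \<longrightarrow> l \<in> U \<longrightarrow> E U \<noteq> 0}"

definition simple_spectral_integral ::
    "(complex set \<Rightarrow> ('a::complex_banach \<Rightarrow>\<^sub>L 'a)) \<Rightarrow> (complex \<Rightarrow> complex) \<Rightarrow> ('a \<Rightarrow>\<^sub>L 'a)" where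
  "simple_spectral_integral E s = (\<Sum>c\<in>range s. scaleC_op c o\<^sub>L E (s -` {c}))"

text \<open>For a bounded Borel function \<open>f\<close>: the limit, in the operator norm, of the integrals of
  simple Borel functions converging uniformly to \<open>f\<close>.\<close>

definition has_spectral_integral ::
    "(complex set \<Rightarrow> ('a::complex_banach \<Rightarrow>\<^sub>L 'a)) \<Rightarrow> (complex \<Rightarrow> complex) \<Rightarrow> ('a \<Rightarrow>\<^sub>L 'a) \<Rightarrow> bool" where
  "has_spectral_integral E f T \<longleftrightarrow> (\<exists>s :: nat \<Rightarrow> complex \<Rightarrow> complex.
     (\<forall>n. simple_function borel (s n)) \<and> uniform_limit UNIV s f sequentially \<and>
     (\<lambda>n. simple_spectral_integral E (s n)) \<longlonglongrightarrow> T)"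

definition spectral_integral ::
    "(complex set \<Rightarrow> ('a::complex_banach \<Rightarrow>\<^sub>L 'a)) \<Rightarrow> complex set \<Rightarrow> (complex \<Rightarrow> complex) \<Rightarrow> ('a \<Rightarrow>\<^sub>L 'a)" where
  "spectral_integral E S f = (THE T. has_spectral_integral E (\<lambda>z. indicator S z * f z) T)"

definition scalar_type_spectral ::
    "'a::complex_banach set \<Rightarrow> ('a \<Rightarrow> 'a) \<Rightarrow> (complex set \<Rightarrow> ('a \<Rightarrow>\<^sub>L 'a)) \<Rightarrow> bool" where
  "scalar_type_spectral D A E \<longleftrightarrow>
     linear_operator_on D A \<and> densely_defined D \<and> closed_operator D A \<and>
     spectral_measure E \<and> spectral_support E = spectrum D A \<and>
     D = {x. convergent (\<lambda>n::nat. spectral_integral E {z. cmod z \<le> real n} (\<lambda>z. z) x)} \<and>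
     (\<forall>x\<in>D. (\<lambda>n::nat. spectral_integral E {z. cmod z \<le> real n} (\<lambda>z. z) x) \<longlonglongrightarrow> A x)"

definition weak_solution :: "'a::complex_banach set \<Rightarrow> ('a \<Rightarrow> 'a) \<Rightarrow> (real \<Rightarrow> 'a) \<Rightarrow> bool" where
  "weak_solution D A y \<longleftrightarrow> continuous_on UNIV y \<and>
     (\<forall>g :: 'a \<Rightarrow>\<^sub>L complex. g \<in> adjoint_domain D A \<longrightarrow> (\<forall>t.
        ((\<lambda>t. g (y t)) has_vector_derivative adjoint_op D A g (y t)) (at t)))"

definition strongly_infinitely_differentiable :: "(real \<Rightarrow> 'a::real_normed_vector) \<Rightarrow> bool" where
  "strongly_infinitely_differentiable y \<longleftrightarrow>
     (\<forall>n t. ((\<lambda>f t. vector_derivative f (at t)) ^^ n) y differentiable (at t))"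

text \<open>The library has \<open>ln 0 = 0\<close> instead of the convention \<open>ln 0 = -\<infinity>\<close>. On the real axis both
  conventions give \<open>Re l \<le> 0 \<or> Re l \<ge> 0\<close>, so the region is the same.\<close>

definition log_region :: "real \<Rightarrow> real \<Rightarrow> complex set" where
  "log_region bm bp = {l. Re l \<le> min 0 (- bm * ln \<bar>Im l\<bar>) \<or> Re l \<ge> max 0 (bp * ln \<bar>Im l\<bar>)}"

lemma real_in_log_region: "Im l = 0 \<Longrightarrow> l \<in> log_region bm bp"
  by (auto simp: log_region_def)

end

theory Submission
  imports Defs
begin

text \<open>
  Why the growth condition decides smoothness. Let \<open>P\<^sub>n\<close> be the spectral projection of the disc of
  radius \<open>n\<close>. On its range \<open>A\<close> is the bounded operator \<open>T\<^sub>n = \<integral> z dE\<close> over that disc, so a weak solution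
  satisfies \<open>(P\<^sub>n y)' = T\<^sub>n y\<close> in norm and hence \<open>P\<^sub>n y(t) = e\<^bsup>-cT\<^sub>n\<^esup> P\<^sub>n y(t + c)\<close> for all real \<open>c\<close>: going
  along the orbit of \<open>y\<close> amounts to multiplying by an exponential of the spectral variable
  (\<open>weak_solution_imp_flow\<close>, \<open>flow_expo\<close>).

  If the spectrum lies in a logarithmic region up to a bounded set, then every spectral point satisfies
  \<open>|z| \<le> C e\<^bsup>c Re z\<^esup>\<close> or \<open>|z| \<le> C e\<^bsup>-c Re z\<^esup>\<close>. On the part of the spectrum with the first bound
  \<open>z e\<^bsup>-cz\<^esup>\<close> is a bounded function, so its spectral integral, applied to \<open>y(t + c)\<close>, is a continuous
  function that plays the role of \<open>A y(t)\<close>; on the other part \<open>y(t - c)\<close> serves the same purpose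
  (\<open>smoothing\<close>). The sum \<open>v\<close> of the two is the derivative of \<open>y\<close>. Translates of solutions and their
  images under operators commuting with all \<open>P\<^sub>n\<close> and \<open>T\<^sub>n\<close> solve the same equations, so \<open>v\<close> is again of
  the same kind as \<open>y\<close>, and induction gives all derivatives (\<open>flow_derivative_flow\<close>).

  If the condition fails for all \<open>b\<close>, there are spectral points \<open>l\<^sub>n\<close> with \<open>|Re l\<^sub>n| < ln |Im l\<^sub>n| / (n + 1)\<close>
  and \<open>|Im l\<^sub>n|\<close> growing as fast as desired. With unit vectors \<open>e\<^sub>n\<close> in the spectral subspaces of
  disjoint unit discs around them, the series of \<open>|Im l\<^sub>n|\<^bsup>-1/2\<^esup> e\<^bsup>tA\<^esup> e\<^sub>n\<close> converges locally uniformly, since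
  \<open>e\<^bsup>tA\<^esup>\<close> grows there more slowly than any power of \<open>|Im l\<^sub>n|\<close>. Its sum is a weak solution, but a derivative at
  \<open>0\<close> would have components of norm about \<open>|Im l\<^sub>n|\<^bsup>1/2\<^esup>\<close>, which is unbounded
  (\<open>nonsmooth_weak_solution\<close>).

  Three general facts carry the analysis. Countable additivity makes the projections uniformly bounded
  (\<open>vector_measure_bounded\<close> and \<open>uniform_boundedness\<close>), which gives the calculus of bounded Borel
  functions. Continuous complex functionals separate points (\<open>dual_space_separates\<close>), which turns the
  weak equation into a norm equation. Finally, a derivative may be identified through any separating
  family of operators (\<open>has_vector_derivative_if_separated\<close>).
\<close>

section \<open>The uniform boundedness principle\<close>

text \<open>By the Baire category theorem one of the closed sets where all operators are bounded by
  \<open>n\<close> contains a ball around some \<open>x\<close>; differences with \<open>x\<close> then bound the operators on a ball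
  around \<open>0\<close>.\<close>

lemma uniform_boundedness:
  fixes F :: "('a::banach \<Rightarrow>\<^sub>L 'b::real_normed_vector) set"
  assumes ptw: "\<And>x. \<exists>B. \<forall>T\<in>F. norm (T x) \<le> B"
  shows "\<exists>B. \<forall>T\<in>F. norm T \<le> B"
proof -
  define C where "C n = {x. \<forall>T\<in>F. norm (T x) \<le> real n}" for n :: nat
  have cl: "closed (C n)" for n
  proof -
    have "C n = (\<Inter>T\<in>F. {x. norm (blinfun_apply T x) \<le> real n})" by (auto simp: C_def)
    moreover have "closed {x. norm (T x) \<le> real n}" for T :: "'a \<Rightarrow>\<^sub>L 'b"
      by (intro closed_Collect_le continuous_intros)
    ultimately show ?thesis by auto
  qed
  have cover: "(\<Union>n. C n) = UNIV"
  proof -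
    have "\<exists>n. x \<in> C n" for x
    proof -
      obtain B where "\<forall>T\<in>F. norm (T x) \<le> B" using ptw by blast
      moreover obtain n where "B \<le> real n" using real_arch_simple by blast
      ultimately show ?thesis unfolding C_def by (blast intro: order_trans)
    qed
    then show ?thesis by auto
  qed
  have "\<exists>n. interior (C n) \<noteq> {}"
  proof (rule ccontr)
    assume "\<not> ?thesis"
    then have emp: "interior (C n) = {}" for n by blast
    have "euclidean closure_of \<Inter>(range (\<lambda>n. - C n)) = topspace (euclidean :: 'a topology)"
    proof (rule Baire_category)
      show "completely_metrizable_space (euclidean :: 'a topology) \<or>
        locally_compact_space (euclidean :: 'a topology) \<and> regular_space (euclidean :: 'a topology)"
        using completely_metrizable_space_euclidean by blast
      show "countable (range (\<lambda>n. - C n))" by auto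
      fix T assume "T \<in> range (\<lambda>n. - C n)"
      then obtain n where T: "T = - C n" by auto
      show "openin euclidean T \<and> euclidean closure_of T = topspace euclidean"
        using cl[of n] emp[of n] by (simp add: T closure_complement open_Compl)
    qed
    moreover have "\<Inter>(range (\<lambda>n. - C n)) = {}" using cover by auto
    ultimately show False by simp
  qed
  then obtain n x e where e: "e > 0" "cball x e \<subseteq> C n"
    by (metis ex_in_conv mem_interior_cball)
  have "norm T \<le> 2 * real n / e" if T: "T \<in> F" for T
  proof (rule norm_blinfun_bound)
    show "0 \<le> 2 * real n / e" using e by auto
    fix y
    show "norm (T y) \<le> 2 * real n / e * norm y"
    proof (cases "y = 0")
      case False
      define w where "w = (e / norm y) *\<^sub>R y"
      have "norm w = e" using False e by (simp add: w_def)
      then have "x + w \<in> C n" "x \<in> C n" using e by (auto simp: subset_iff dist_norm)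
      then have "norm (T (x + w)) \<le> n" "norm (T x) \<le> n" using T by (auto simp: C_def)
      moreover have "T w = T (x + w) - T x" by (simp add: blinfun.add_right)
      ultimately have "norm (T w) \<le> 2 * real n" by (smt (verit) norm_triangle_ineq4)
      moreover have "norm (T w) = e / norm y * norm (T y)"
        using e by (simp add: w_def blinfun.scaleR_right)
      ultimately show ?thesis using e False by (simp add: field_simps)
    qed auto
  qed
  then show ?thesis by blast
qed

section \<open>Separation of points by continuous functionals\<close>

text \<open>The Hahn-Banach theorem is reached through sublinear functionals that are minimal in the
  pointwise order. These are defined on the whole space, so no extension of domains has to be handled;
  minimality alone forces additivity.\<close>

definition sublinear :: "('a::real_vector \<Rightarrow> real) \<Rightarrow> bool" where
  "sublinear p \<longleftrightarrow> (\<forall>x y. p (x + y) \<le> p x + p y) \<and> (\<forall>r\<ge>0. \<forall>x. p (r *\<^sub>R x) = r * p x)"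

lemma sublinearD:
  assumes "sublinear p"
  shows "p (x + y) \<le> p x + p y" "r \<ge> 0 \<Longrightarrow> p (r *\<^sub>R x) = r * p x" "p 0 = 0" "- p (- x) \<le> p x"
proof -
  show 1: "p (x + y) \<le> p x + p y" for x y using assms by (auto simp: sublinear_def)
  show 2: "r \<ge> 0 \<Longrightarrow> p (r *\<^sub>R x) = r * p x" for x r using assms by (auto simp: sublinear_def)
  show 0: "p 0 = 0" using 2[of 0 0] by simp
  show "- p (- x) \<le> p x" using 1[of x "- x"] 0 by simp
qed

lemma sublinearI:
  assumes "\<And>x y. p (x + y) \<le> p x + p y" "p 0 = 0" "\<And>r x. r > 0 \<Longrightarrow> p (r *\<^sub>R x) \<le> r * p x"
  shows "sublinear p"
  unfolding sublinear_def
proof (intro conjI allI impI)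
  show "p (r *\<^sub>R x) = r * p x" if "r \<ge> 0" for r x
  proof (cases "r = 0")
    case False
    then have r: "r > 0" using that by simp
    then have "p x \<le> inverse r * p (r *\<^sub>R x)" using assms(3)[of "inverse r" "r *\<^sub>R x"] by simp
    then have "r * p x \<le> p (r *\<^sub>R x)" using r by (simp add: field_simps)
    then show ?thesis using assms(3)[OF r, of x] by simp
  qed (simp add: assms)
qed (rule assms)

text \<open>The infimum of \<open>p (x + t *\<^sub>R z) - t * p z\<close> over \<open>t \<ge> 0\<close> lowers \<open>p\<close> so as to make it
  linear in the direction \<open>z\<close>. It is used twice: for a minimal \<open>p\<close> it can change nothing, which shows
  that \<open>p\<close> is additive; and applied to the norm it produces a functional whose value at \<open>- z\<close> is as
  small as possible.\<close>

lemma sublinear_flatten: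
  fixes p :: "'a::real_vector \<Rightarrow> real"
  assumes p: "sublinear p"
  obtains q where "sublinear q" "\<And>x. q x \<le> p x" "\<And>x. q x \<le> p (x + z) - p z"
proof
  define h where "h x t = p (x + t *\<^sub>R z) - t * p z" for x t
  define q where "q x = (INF t\<in>{0..}. h x t)" for x
  have low: "- p (- x) \<le> h x t" if "t \<ge> 0" for x t
  proof -
    have "t * p z = p (- x + (x + t *\<^sub>R z))" using sublinearD(2)[OF p that] by simp
    also have "\<dots> \<le> p (- x) + p (x + t *\<^sub>R z)" by (rule sublinearD(1)[OF p])
    finally show ?thesis by (simp add: h_def)
  qed
  have le: "q x \<le> h x t" if "t \<ge> 0" for x t
    unfolding q_def using low that by (intro cINF_lower bdd_belowI2) auto
  have ge: "b \<le> q x" if "\<And>t. t \<ge> 0 \<Longrightarrow> b \<le> h x t" for b x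
    unfolding q_def using that by (intro cINF_greatest) auto
  show "q x \<le> p x" for x using le[of 0 x] by (simp add: h_def)
  show "q x \<le> p (x + z) - p z" for x using le[of 1 x] by (simp add: h_def)
  show "sublinear q"
  proof (rule sublinearI)
    fix x y
    have *: "q (x + y) \<le> h x s + h y t" if "s \<ge> 0" "t \<ge> 0" for s t
    proof -
      have "h (x + y) (s + t) \<le> h x s + h y t"
        using sublinearD(1)[OF p, of "x + s *\<^sub>R z" "y + t *\<^sub>R z"] by (simp add: h_def algebra_simps)
      then show ?thesis using le[of "s + t" "x + y"] that by simp
    qed
    have "q (x + y) - h x s \<le> q y" if "s \<ge> 0" for s
      using *[OF that] by (intro ge) (simp add: algebra_simps)
    then have "q (x + y) - q y \<le> q x" by (intro ge) (simp add: algebra_simps)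
    then show "q (x + y) \<le> q x + q y" by simp
  next
    have "h 0 t = 0" if "t \<ge> 0" for t using sublinearD(2)[OF p that] by (simp add: h_def)
    then show "q 0 = 0" using le[of 0 0] ge[of 0 0] by force
  next
    fix r :: real and x :: 'a assume r: "r > 0"
    have "q (r *\<^sub>R x) / r \<le> h x t" if "t \<ge> 0" for t
    proof -
      have "h (r *\<^sub>R x) (r * t) = r * h x t"
        using sublinearD(2)[OF p, of r "x + t *\<^sub>R z"] r by (simp add: h_def algebra_simps)
      then show ?thesis using le[of "r * t" "r *\<^sub>R x"] r that by (simp add: field_simps)
    qed
    then have "q (r *\<^sub>R x) / r \<le> q x" by (rule ge)
    then show "q (r *\<^sub>R x) \<le> r * q x" using r by (simp add: field_simps)
  qed
qed

text \<open>Zorn's lemma for the reversed pointwise order. Chains have pointwise infima, because every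
  sublinear functional below \<open>q\<close> is bounded from below by \<open>- q (- x)\<close>.\<close>

lemma minimal_sublinear_exists:
  fixes q :: "'a::real_vector \<Rightarrow> real"
  assumes q: "sublinear q"
  obtains m where "sublinear m" "\<And>x. m x \<le> q x"
    "\<And>p. sublinear p \<Longrightarrow> (\<And>x. p x \<le> m x) \<Longrightarrow> p = m"
proof -
  define S where "S = {p. sublinear p \<and> (\<forall>x. p x \<le> q x)}"
  define P where "P = (\<lambda>a b :: 'a \<Rightarrow> real. \<forall>x. b x \<le> a x)"
  have "\<exists>m\<in>S. \<forall>a\<in>S. P m a \<longrightarrow> a = m"
  proof (rule predicate_Zorn)
    show "partial_order_on S (relation_of P S)"
      by (rule partial_order_on_relation_ofI) (auto simp: P_def fun_eq_iff intro: order_trans antisym)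
    fix C assume C: "C \<in> Chains (relation_of P S)"
    show "\<exists>u\<in>S. \<forall>a\<in>C. P a u"
    proof (cases "C = {}")
      case True then show ?thesis using q by (auto simp: S_def)
    next
      case False
      have CS: "C \<subseteq> S" and total: "\<And>a b. a \<in> C \<Longrightarrow> b \<in> C \<Longrightarrow> P a b \<or> P b a"
        using C by (auto simp: Chains_def relation_of_def)
      define u where "u x = (INF a\<in>C. a x)" for x
      have sub: "sublinear a" "a x \<le> q x" if "a \<in> C" for a x using CS that by (auto simp: S_def)
      have low: "- q (- x) \<le> a x" if "a \<in> C" for a x
        using sub[OF that] sublinearD(4)[OF sub(1)[OF that], of x] by (meson neg_le_iff_le order_trans)
      have le: "u x \<le> a x" if "a \<in> C" for a x
        unfolding u_def using low that by (intro cINF_lower bdd_belowI2) auto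
      have ge: "b \<le> u x" if "\<And>a. a \<in> C \<Longrightarrow> b \<le> a x" for b x
        unfolding u_def using that False by (intro cINF_greatest) auto
      have "sublinear u"
      proof (rule sublinearI)
        fix x y
        have *: "u (x + y) \<le> a x + b y" if ab: "a \<in> C" "b \<in> C" for a b
          using total[OF ab] le[OF ab(1), of "x + y"] le[OF ab(2), of "x + y"]
            sublinearD(1)[OF sub(1)[OF ab(1)], of x y] sublinearD(1)[OF sub(1)[OF ab(2)], of x y]
          unfolding P_def by (smt (verit))
        have "u (x + y) - a x \<le> u y" if "a \<in> C" for a
          using *[OF that] by (intro ge) (simp add: algebra_simps)
        then have "u (x + y) - u y \<le> u x" by (intro ge) (simp add: algebra_simps)
        then show "u (x + y) \<le> u x + u y" by simp
      next
        have z: "a 0 = 0" if "a \<in> C" for a using sublinearD(3)[OF sub(1)[OF that]] .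
        obtain a where "a \<in> C" using False by blast
        then show "u 0 = 0" using le[of a 0] ge[of 0 0] z by force
      next
        fix r :: real and x :: 'a assume r: "r > 0"
        have "u (r *\<^sub>R x) / r \<le> a x" if "a \<in> C" for a
          using le[OF that, of "r *\<^sub>R x"] sublinearD(2)[OF sub(1)[OF that], of r x] r
          by (simp add: field_simps)
        then have "u (r *\<^sub>R x) / r \<le> u x" by (rule ge)
        then show "u (r *\<^sub>R x) \<le> r * u x" using r by (simp add: field_simps)
      qed
      moreover have "u x \<le> q x" for x using False le sub(2) by (meson ex_in_conv order_trans)
      ultimately show ?thesis using le by (intro bexI[of _ u]) (auto simp: S_def P_def)
    qed
  qed
  then obtain m where m: "m \<in> S" "\<And>a. a \<in> S \<Longrightarrow> P m a \<Longrightarrow> a = m" by blast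
  show ?thesis
  proof
    show "sublinear m" "\<And>x. m x \<le> q x" using m(1) by (auto simp: S_def)
    fix p assume "sublinear p" "\<And>x. p x \<le> m x"
    moreover have "p x \<le> q x" for x using m(1) calculation(2)[of x] by (auto simp: S_def intro: order_trans)
    ultimately show "p = m" using m(2)[of p] by (auto simp: S_def P_def)
  qed
qed

text \<open>A minimal sublinear functional below the norm could be zero at \<open>x0\<close>; flattening the norm
  along \<open>x0\<close> first forces the value at \<open>- x0\<close> to be at most \<open>- norm x0\<close>.\<close>

lemma real_functional_nonzero:
  fixes x0 :: "'a::real_normed_vector"
  assumes "x0 \<noteq> 0"
  obtains f :: "'a \<Rightarrow>\<^sub>L real" where "f x0 \<noteq> 0"
proof -
  have n: "sublinear (norm :: 'a \<Rightarrow> real)" by (simp add: sublinear_def norm_triangle_ineq)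
  obtain q where q: "sublinear q" "\<And>x. q x \<le> norm x" "\<And>x. q x \<le> norm (x + x0) - norm x0"
    using sublinear_flatten[OF n] by blast
  obtain m where m: "sublinear m" "\<And>x. m x \<le> q x"
    and min: "\<And>p. sublinear p \<Longrightarrow> (\<And>x. p x \<le> m x) \<Longrightarrow> p = m"
    using minimal_sublinear_exists[OF q(1)] by blast
  have add: "m (x + y) = m x + m y" for x y
  proof -
    obtain p where p: "sublinear p" "\<And>x. p x \<le> m x" "\<And>x. p x \<le> m (x + y) - m y"
      using sublinear_flatten[OF m(1)] by blast
    have "p = m" using p by (intro min) auto
    then show ?thesis using p(3)[of x] sublinearD(1)[OF m(1), of x y] by simp
  qed
  have neg: "m (- x) = - m x" for x using add[of x "- x"] sublinearD(3)[OF m(1)] by simp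
  have scale: "m (r *\<^sub>R x) = r * m x" for r x
  proof (cases "r \<ge> 0")
    case False
    then show ?thesis using sublinearD(2)[OF m(1), of "- r" x] neg[of "r *\<^sub>R x"] by simp
  qed (simp add: sublinearD(2)[OF m(1)])
  have "m x \<le> norm x" for x using m(2)[of x] q(2)[of x] by simp
  then have "\<bar>m x\<bar> \<le> norm x" for x by (smt (verit) neg norm_minus_cancel)
  then have "bounded_linear m"
    by (intro bounded_linear_intro[of _ 1]) (auto simp: add scale)
  moreover have "m (- x0) \<le> - norm x0" using m(2)[of "- x0"] q(3)[of "- x0"] by simp
  then have "m x0 \<noteq> 0" using assms neg[of x0] by auto
  ultimately show ?thesis using that[of "Blinfun m"] by (simp add: bounded_linear_Blinfun_apply)
qed

text \<open>A real functional \<open>f\<close> is the real part of the complex functional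
  \<open>x \<mapsto> f x - \<i> f (\<i> x)\<close>.\<close>

lemma dual_space_separates:
  fixes x0 :: "'a::complex_banach"
  assumes "\<And>g :: 'a \<Rightarrow>\<^sub>L complex. g \<in> dual_space \<Longrightarrow> g x0 = 0"
  shows "x0 = 0"
proof (rule ccontr)
  assume "x0 \<noteq> 0"
  then obtain f :: "'a \<Rightarrow>\<^sub>L real" where f: "f x0 \<noteq> 0" using real_functional_nonzero by blast
  define g where "g = (\<lambda>x. Complex (f x) (- f (\<i> *\<^sub>C x)))"
  have bl: "bounded_linear g"
  proof -
    have "bounded_linear (\<lambda>x. of_real (f x) - \<i> * of_real (f (\<i> *\<^sub>C x)) :: complex)"
      by (intro bounded_linear_sub bounded_linear_compose[OF bounded_linear_mult_right]
          bounded_linear_compose[OF bounded_linear_of_real] blinfun.bounded_linear_right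
          bounded_linear_compose[OF blinfun.bounded_linear_right bounded_linear_scaleC])
    moreover have "g = (\<lambda>x. of_real (f x) - \<i> * of_real (f (\<i> *\<^sub>C x)))"
      by (auto simp: g_def complex_eq_iff)
    ultimately show ?thesis by simp
  qed
  have split: "c *\<^sub>C x = Re c *\<^sub>R x + Im c *\<^sub>R (\<i> *\<^sub>C x)" for c and x :: 'a
    by (simp add: scaleR_scaleC scaleC_scaleC flip: scaleC_add_left)
      (metis complex_eq mult.commute)
  have ii: "\<i> *\<^sub>C \<i> *\<^sub>C x = - x" for x :: 'a
    using scaleR_scaleC[of "- 1" x] by (simp add: scaleC_scaleC)
  have "g (c *\<^sub>C x) = c * g x" for c x
  proof -
    have "\<i> *\<^sub>C c *\<^sub>C x = Re c *\<^sub>R (\<i> *\<^sub>C x) + Im c *\<^sub>R (- x)"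
      by (subst split[of c]) (simp add: scaleC_add_right scaleR_scaleC scaleC_scaleC mult.commute ii[unfolded scaleC_scaleC] flip: ii)
    then show ?thesis
      by (simp add: g_def split[of c x] blinfun.add_right blinfun.scaleR_right blinfun.minus_right blinfun.diff_right complex_eq_iff)
  qed
  then have "Blinfun g \<in> dual_space"
    using bl by (simp add: dual_space_def bounded_linear_Blinfun_apply)
  then have "g x0 = 0" using assms bl by (metis bounded_linear_Blinfun_apply)
  then show False using f by (simp add: g_def complex_eq_iff)
qed

section \<open>Boundedness of vector measures and tests for derivatives\<close>

text \<open>The norm is convex, so over the cube of coefficients it is bounded by its values at the
  vertices. The offset \<open>w\<close> lets the induction fix one coefficient at a time. Applied to the values of a
  vector measure on a partition, the vertices are values of the measure itself.\<close>

lemma convex_coefficients_bound: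
  fixes v :: "'i \<Rightarrow> 'a::real_normed_vector"
  assumes "finite I" "\<And>i. i \<in> I \<Longrightarrow> 0 \<le> c i \<and> c i \<le> 1"
    and "\<And>J. J \<subseteq> I \<Longrightarrow> norm (w + (\<Sum>i\<in>J. v i)) \<le> M"
  shows "norm (w + (\<Sum>i\<in>I. c i *\<^sub>R v i)) \<le> M"
  using assms
proof (induction I arbitrary: w rule: finite_induct)
  case (insert i I)
  let ?s = "\<Sum>i\<in>I. c i *\<^sub>R v i"
  have "norm (w + (\<Sum>i\<in>J. v i)) \<le> M" if "J \<subseteq> I" for J using insert.prems(2) that by blast
  then have a: "norm (w + ?s) \<le> M" using insert.IH insert.prems by blast
  have "norm ((w + v i) + (\<Sum>i\<in>J. v i)) \<le> M" if "J \<subseteq> I" for J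
  proof -
    have "finite J" "i \<notin> J" using that insert.hyps by (auto intro: finite_subset)
    then show ?thesis using insert.prems(2)[of "insert i J"] that by (auto simp: add.assoc)
  qed
  then have b: "norm ((w + v i) + ?s) \<le> M" using insert.IH insert.prems by blast
  have c: "0 \<le> c i" "c i \<le> 1" using insert.prems(1) by auto
  have "w + (\<Sum>i\<in>insert i I. c i *\<^sub>R v i) = (1 - c i) *\<^sub>R (w + ?s) + c i *\<^sub>R ((w + v i) + ?s)"
    using insert.hyps by (simp add: algebra_simps)
  also have "norm \<dots> \<le> (1 - c i) * norm (w + ?s) + c i * norm ((w + v i) + ?s)"
    using c by (intro norm_triangle_le) simp
  also have "\<dots> \<le> (1 - c i) * M + c i * M"
    using a b c by (intro add_mono mult_left_mono) auto
  finally show ?case by (simp add: algebra_simps)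
qed auto

text \<open>If the measure is unbounded on a set, then it is unbounded on one of two pieces while the
  other has norm at least \<open>1\<close>. Cutting off such pieces forever gives disjoint sets whose measures do
  not tend to \<open>0\<close>, against countable additivity.\<close>

lemma vector_measure_bounded:
  fixes \<mu> :: "'s set \<Rightarrow> 'b::real_normed_vector"
  assumes sa: "sigma_algebra \<Omega> \<M>"
    and add: "\<And>S T. S \<in> \<M> \<Longrightarrow> T \<in> \<M> \<Longrightarrow> S \<inter> T = {} \<Longrightarrow> \<mu> (S \<union> T) = \<mu> S + \<mu> T"
    and ca: "\<And>F :: nat \<Rightarrow> 's set. range F \<subseteq> \<M> \<Longrightarrow> disjoint_family F \<Longrightarrow> (\<lambda>i. \<mu> (F i)) sums \<mu> (\<Union>i. F i)"
  shows "\<exists>B. \<forall>S\<in>\<M>. norm (\<mu> S) \<le> B"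
proof (rule ccontr)
  interpret sigma_algebra \<Omega> \<M> by (rule sa)
  define Unb where "Unb S \<longleftrightarrow> S \<in> \<M> \<and> (\<forall>B. \<exists>T\<in>\<M>. T \<subseteq> S \<and> norm (\<mu> T) > B)" for S
  assume "\<not> ?thesis"
  then have top: "Unb \<Omega>" unfolding Unb_def using sets_into_space by (metis not_le top)
  have step: "\<exists>T. Unb T \<and> T \<subseteq> S \<and> norm (\<mu> (S - T)) \<ge> 1" if S: "Unb S" for S
  proof -
    obtain T where T: "T \<in> \<M>" "T \<subseteq> S" "norm (\<mu> T) > norm (\<mu> S) + 1"
      using S unfolding Unb_def by blast
    have SM: "S \<in> \<M>" using S by (simp add: Unb_def)
    have "T \<union> (S - T) = S" "S - T \<in> \<M>" using T SM by auto
    then have "\<mu> S = \<mu> T + \<mu> (S - T)" using add[of T "S - T"] T(1) by simp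
    then have big: "norm (\<mu> (S - T)) \<ge> 1" "norm (\<mu> T) \<ge> 1"
      using T(3) norm_triangle_ineq[of "\<mu> S" "- \<mu> (S - T)"] norm_ge_zero[of "\<mu> S"] by (auto; smt (verit) norm_ge_zero norm_minus_cancel add_diff_cancel_right' norm_triangle_ineq4)+
    \<comment> \<open>Each measurable subset splits along \<open>T\<close>, so bounds on both pieces would bound \<open>S\<close>.\<close>
    have "Unb T \<or> Unb (S - T)"
    proof (rule ccontr)
      assume "\<not> ?thesis"
      then obtain B1 B2 where B: "\<And>R. R \<in> \<M> \<Longrightarrow> R \<subseteq> T \<Longrightarrow> norm (\<mu> R) \<le> B1"
        "\<And>R. R \<in> \<M> \<Longrightarrow> R \<subseteq> S - T \<Longrightarrow> norm (\<mu> R) \<le> B2"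
        using T(1) SM unfolding Unb_def by (meson Diff not_le)
      obtain R where R: "R \<in> \<M>" "R \<subseteq> S" "norm (\<mu> R) > B1 + B2" using S unfolding Unb_def by blast
      have eq: "\<mu> R = \<mu> (R \<inter> T) + \<mu> (R - T)"
        using add[of "R \<inter> T" "R - T"] R(1) T(1) by (simp add: Int_Diff_Un Int_Diff_disjoint Int Diff)
      have "norm (\<mu> (R \<inter> T)) \<le> B1" "norm (\<mu> (R - T)) \<le> B2"
        using B R T by auto
      then show False
        using R(3) norm_triangle_ineq[of "\<mu> (R \<inter> T)" "\<mu> (R - T)"] unfolding eq by linarith
    qed
    then show ?thesis
    proof
      assume "Unb T" then show ?thesis using T big by blast
    next
      assume "Unb (S - T)"
      moreover have "S - (S - T) = T" using T by blast
      ultimately show ?thesis using big by (metis Diff_subset)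
    qed
  qed
  obtain G where G0: "G 0 = \<Omega>" and G: "\<And>n. Unb (G n)" "\<And>n. G (Suc n) \<subseteq> G n" "\<And>n. norm (\<mu> (G n - G (Suc n))) \<ge> 1"
  proof -
    obtain nxt where nxt: "\<And>S. Unb S \<Longrightarrow> Unb (nxt S) \<and> nxt S \<subseteq> S \<and> norm (\<mu> (S - nxt S)) \<ge> 1"
      using step by metis
    define f where "f n = (nxt ^^ n) \<Omega>" for n
    have "Unb (f n)" for n by (induction n) (use top nxt in \<open>auto simp: f_def\<close>)
    moreover have "f (Suc n) = nxt (f n)" "f 0 = \<Omega>" for n by (simp_all add: f_def)
    ultimately have "(\<forall>n. Unb (f n)) \<and> f 0 = \<Omega> \<and> (\<forall>n. f (Suc n) \<subseteq> f n \<and> norm (\<mu> (f n - f (Suc n))) \<ge> 1)"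
      using nxt by metis
    then show ?thesis using that by blast
  qed
  define H where "H n = G n - G (Suc n)" for n
  have anti: "G n \<subseteq> G m" if "m \<le> n" for m n
    using that by (induction rule: dec_induct) (use G(2) in auto)
  have "disjoint_family H"
    unfolding disjoint_family_on_def
  proof (intro ballI impI)
    have "H m \<inter> H n = {}" if "m < n" for m n
      using anti[of "Suc m" n] that by (auto simp: H_def)
    then show "H m \<inter> H n = {}" if "m \<noteq> n" for m n
      using that by (metis Int_commute linorder_neqE_nat)
  qed
  moreover have "range H \<subseteq> \<M>" using G(1) by (auto simp: H_def Unb_def)
  ultimately have "(\<lambda>i. \<mu> (H i)) sums \<mu> (\<Union>i. H i)" using ca by blast
  then have "(\<lambda>i. norm (\<mu> (H i))) \<longlonglongrightarrow> 0"
    using summable_LIMSEQ_zero sums_summable tendsto_norm_zero by blast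
  then have "(1::real) \<le> 0"
    using G(3) by (intro tendsto_lowerbound[of _ 0 sequentially 1]) (auto simp: H_def)
  then show False by simp
qed

text \<open>Compare \<open>u\<close> with a local antiderivative of \<open>v\<close>: their difference has derivative \<open>0\<close> under
  every \<open>L i\<close>, so it is constant because the \<open>L i\<close> separate points. The continuity of \<open>v\<close> is essential.
  The family \<open>L\<close> will consist of functionals in one application and of spectral projections in the
  other.\<close>

lemma has_vector_derivative_if_separated:
  fixes u v :: "real \<Rightarrow> 'a::banach" and L :: "'i \<Rightarrow> 'a \<Rightarrow>\<^sub>L 'b::real_normed_vector"
  assumes sep: "\<And>x. (\<And>i. i \<in> I \<Longrightarrow> L i x = 0) \<Longrightarrow> x = 0"
    and v: "continuous_on UNIV v"
    and der: "\<And>i t. i \<in> I \<Longrightarrow> ((\<lambda>t. L i (u t)) has_vector_derivative L i (v t)) (at t)"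
  shows "(u has_vector_derivative v t) (at t)"
proof -
  let ?J = "{t - 1<..<t + 1}"
  define F where "F x = integral {t - 1..x} v" for x
  have F: "(F has_vector_derivative v x) (at x)" if "x \<in> ?J" for x
  proof -
    have "(F has_vector_derivative v x) (at x within {t - 1..t + 1})"
      unfolding F_def using that v
      by (intro integral_has_vector_derivative) (auto intro: continuous_on_subset)
    then have "(F has_vector_derivative v x) (at x within ?J)"
      by (rule has_vector_derivative_within_subset) auto
    then show ?thesis
      using has_vector_derivative_within_open[OF that open_greaterThanLessThan] by blast
  qed
  have eq: "u x - F x = u t - F t" if x: "x \<in> ?J" for x
  proof -
    have "L i ((u x - F x) - (u t - F t)) = 0" if "i \<in> I" for i
    proof -
      have "((\<lambda>x. L i (u x - F x)) has_vector_derivative 0) (at x within ?J)" if x: "x \<in> ?J" for x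
      proof -
        have "((\<lambda>x. L i (F x)) has_vector_derivative L i (v x)) (at x)"
          by (rule bounded_linear.has_vector_derivative[OF blinfun.bounded_linear_right F[OF x]])
        from has_vector_derivative_diff[OF der[OF \<open>i \<in> I\<close>] this]
        show ?thesis by (simp add: blinfun.diff_right has_vector_derivative_at_within)
      qed
      then obtain c where "\<And>x. x \<in> ?J \<Longrightarrow> L i (u x - F x) = c"
        using has_vector_derivative_zero_constant[of ?J "\<lambda>x. L i (u x - F x)"] by auto
      then have "L i (u x - F x) = L i (u t - F t)" using x by simp
      then show ?thesis by (simp add: blinfun.diff_right)
    qed
    then show ?thesis using sep by force
  qed
  have "((\<lambda>x. F x + (u t - F t)) has_vector_derivative v t) (at t)"
    using F[of t] has_vector_derivative_add_const by fastforce
  then show ?thesis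
    by (rule has_vector_derivative_transform_within_open[of _ _ _ ?J]) (use eq in \<open>auto simp: algebra_simps\<close>)
qed

lemma scaleC_sum_right: "c *\<^sub>C (\<Sum>i\<in>I. v i) = (\<Sum>i\<in>I. c *\<^sub>C (v i :: 'a::complex_banach))"
  by (rule linear_sum[OF bounded_linear.linear[OF bounded_linear_scaleC]])

lemma scaleC_zero [simp]: "0 *\<^sub>C (x :: 'a::complex_banach) = 0" "c *\<^sub>C (0 :: 'a) = 0"
  using norm_scaleC[of 0 x] norm_scaleC[of c "0::'a"] by auto

lemma scaleC_one [simp]: "1 *\<^sub>C (x :: 'a::complex_banach) = x"
  using scaleR_scaleC[of 1 x] by simp

lemma scaleC_minus [simp]: "(- c) *\<^sub>C (x :: 'a::complex_banach) = - (c *\<^sub>C x)"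
  using scaleC_add_left[of "- c" c x] by (simp add: eq_neg_iff_add_eq_0)

text \<open>Derivatives of spectral integrals are obtained in this form, from Taylor estimates that are
  uniform on a bounded set.\<close>

lemma has_vector_derivative_quadratic:
  fixes f :: "real \<Rightarrow> 'b::real_normed_vector"
  assumes "\<And>h. \<bar>h\<bar> \<le> 1 \<Longrightarrow> norm (f (t + h) - f t - h *\<^sub>R d) \<le> C * h\<^sup>2"
  shows "(f has_vector_derivative d) (at t)"
  unfolding has_vector_derivative_def has_derivative_at
proof (intro conjI bounded_linear_scaleR_left)
  show "(\<lambda>h. norm (f (t + h) - f t - h *\<^sub>R d) / norm h) \<midarrow>0\<rightarrow> 0"
  proof (rule Lim_null_comparison)
    have "\<forall>\<^sub>F h in at 0. \<bar>h\<bar> < (1::real) \<and> h \<noteq> 0"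
      unfolding eventually_at by (intro exI[of _ 1]) auto
    then show "\<forall>\<^sub>F h in at 0. norm (norm (f (t + h) - f t - h *\<^sub>R d) / norm h) \<le> C * \<bar>h\<bar>"
    proof (rule eventually_mono)
      fix h :: real assume h: "\<bar>h\<bar> < 1 \<and> h \<noteq> 0"
      then have "norm (f (t + h) - f t - h *\<^sub>R d) / \<bar>h\<bar> \<le> C * h\<^sup>2 / \<bar>h\<bar>"
        using assms[of h] by (intro divide_right_mono) auto
      also have "\<dots> = C * \<bar>h\<bar>" using h by (simp add: power2_eq_square field_simps)
      finally show "norm (norm (f (t + h) - f t - h *\<^sub>R d) / norm h) \<le> C * \<bar>h\<bar>" by simp
    qed
    show "(\<lambda>h. C * \<bar>h\<bar>) \<midarrow>0\<rightarrow> 0" by (intro tendsto_eq_intros) auto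
  qed
qed

definition bounded_borel :: "(complex \<Rightarrow> complex) \<Rightarrow> bool" where
  "bounded_borel f \<longleftrightarrow> f \<in> borel_measurable borel \<and> bounded (range f)"

section \<open>Spectral measures\<close>

locale spectral_calculus =
  fixes E :: "complex set \<Rightarrow> ('a::complex_banach \<Rightarrow>\<^sub>L 'a)"
  assumes sm: "spectral_measure E"
begin

lemma E_empty: "E {} = 0" and E_UNIV: "E UNIV = id_blinfun"
  and E_scaleC: "S \<in> sets borel \<Longrightarrow> E S (c *\<^sub>C x) = c *\<^sub>C E S x"
  and E_sums: "range F \<subseteq> sets borel \<Longrightarrow> disjoint_family F \<Longrightarrow> (\<lambda>i::nat. E (F i) x) sums E (\<Union>i. F i) x"
  using sm unfolding spectral_measure_def complex_linear_op_def by auto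

lemma E_Int: "S \<in> sets borel \<Longrightarrow> T \<in> sets borel \<Longrightarrow> E S (E T x) = E (S \<inter> T) x"
  using sm unfolding spectral_measure_def by (metis blinfun_apply_blinfun_compose)

lemma E_Un:
  assumes "S \<in> sets borel" "T \<in> sets borel" "S \<inter> T = {}"
  shows "E (S \<union> T) x = E S x + E T x"
proof -
  have "(\<lambda>i. E (binaryset S T i) x) sums E (S \<union> T) x"
  proof -
    have "range (binaryset S T) \<subseteq> sets borel" using assms by (auto simp: range_binaryset_eq)
    moreover have "disjoint_family (binaryset S T)"
      using assms by (auto simp: disjoint_family_on_def binaryset_def)
    ultimately show ?thesis using E_sums[of "binaryset S T" x] by (simp only: UN_binaryset_eq)
  qed
  moreover have "(\<lambda>i. E (binaryset S T i) x) sums (\<Sum>i\<in>{0,1}. E (binaryset S T i) x)"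
    by (rule sums_finite) (auto simp: binaryset_def E_empty)
  ultimately have "E (S \<union> T) x = (\<Sum>i\<in>{0,1}. E (binaryset S T i) x)" using sums_unique2 by blast
  then show ?thesis by (simp add: binaryset_def)
qed

lemma E_UN_finite:
  assumes "finite I" "\<And>i. i \<in> I \<Longrightarrow> S i \<in> sets borel" "disjoint_family_on S I"
  shows "E (\<Union>i\<in>I. S i) x = (\<Sum>i\<in>I. E (S i) x)"
  using assms
proof (induction I rule: finite_induct)
  case (insert i I)
  have "S i \<inter> (\<Union>i\<in>I. S i) = {}" using insert by (auto simp: disjoint_family_on_def)
  then have "E (S i \<union> (\<Union>i\<in>I. S i)) x = E (S i) x + E (\<Union>i\<in>I. S i) x"
    using insert by (intro E_Un sets.finite_UN) auto
  moreover have "disjoint_family_on S I" using insert.prems by (simp add: disjoint_family_on_def)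
  ultimately show ?case using insert by simp
qed (simp add: E_empty)

lemma E_incseq:
  assumes "range S \<subseteq> sets borel" "incseq S"
  shows "(\<lambda>n. E (S n) x) \<longlonglongrightarrow> E (\<Union>n. S n) x"
proof -
  have b: "range (disjointed S) \<subseteq> sets borel"
    using assms(1) sets.range_disjointed_sets by blast
  have "(\<lambda>i. E (disjointed S i) x) sums E (\<Union>n. S n) x"
    using E_sums[OF b disjoint_family_disjointed] by (simp add: UN_disjointed_eq)
  then have "(\<lambda>n. \<Sum>i<Suc n. E (disjointed S i) x) \<longlonglongrightarrow> E (\<Union>n. S n) x"
    unfolding sums_def by (rule LIMSEQ_Suc)
  moreover have "(\<Sum>i<Suc n. E (disjointed S i) x) = E (S n) x" for n
  proof -
    have "(\<Union>i<Suc n. disjointed S i) = (\<Union>i\<in>{0..<Suc n}. S i)"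
      by (metis atLeast0LessThan finite_UN_disjointed_eq)
    also have "\<dots> = S n"
      using assms(2) by (fastforce simp: incseq_def less_Suc_eq_le)
    finally have "(\<Union>i<Suc n. disjointed S i) = S n" .
    moreover have "E (\<Union>i<Suc n. disjointed S i) x = (\<Sum>i<Suc n. E (disjointed S i) x)"
      using b disjoint_family_disjointed[of S]
      by (intro E_UN_finite) (auto simp: disjoint_family_on_def)
    ultimately show ?thesis by simp
  qed
  ultimately show ?thesis by simp
qed

lemma E_subset_null:
  assumes "E S = 0" "T \<subseteq> S" "S \<in> sets borel" "T \<in> sets borel"
  shows "E T = 0"
proof (rule blinfun_eqI)
  show "E T x = blinfun_apply 0 x" for x
    using E_Int[of T S x] assms by (simp add: Int_absorb2)
qed

lemma E_UN_null:
  assumes S: "range S \<subseteq> sets borel" and null: "\<And>n::nat. E (S n) = 0"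
  shows "E (\<Union>n. S n) = 0"
proof (rule blinfun_eqI)
  fix x
  have b: "range (disjointed S) \<subseteq> sets borel"
    using S sets.range_disjointed_sets by blast
  have "E (disjointed S n) = 0" for n
    using b S by (intro E_subset_null[OF null[of n] disjointed_subset[of S n]]) auto
  then have "(\<lambda>i. 0) sums E (\<Union>n. S n) x"
    using E_sums[OF b disjoint_family_disjointed, of x] by (simp add: UN_disjointed_eq)
  then have "0 = E (\<Union>n. S n) x" by (rule sums_unique2[OF sums_zero])
  then show "E (\<Union>n. S n) x = blinfun_apply 0 x" by simp
qed

text \<open>The complement of the support is covered by open null sets, of which countably many suffice
  by the Lindelof property.\<close>

lemma support_complement:
  "open (- spectral_support E)" "E (- spectral_support E) = 0"
proof -
  define \<U> where "\<U> = {U. open U \<and> E U = 0}"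
  have eq: "- spectral_support E = \<Union>\<U>" by (auto simp: spectral_support_def \<U>_def)
  show "open (- spectral_support E)" unfolding eq by (auto simp: \<U>_def)
  obtain \<V> where V: "\<V> \<subseteq> \<U>" "countable \<V>" "\<Union>\<V> = \<Union>\<U>"
    using Lindelof[of \<U>] by (auto simp: \<U>_def)
  show "E (- spectral_support E) = 0"
  proof (cases "\<V> = {}")
    case True then show ?thesis unfolding eq V(3)[symmetric] by (simp add: E_empty)
  next
    case False
    have "from_nat_into \<V> n \<in> \<U>" for n using from_nat_into[OF False] V(1) by blast
    then have "E (\<Union>n. from_nat_into \<V> n) = 0"
      by (intro E_UN_null) (auto simp: \<U>_def)
    then show ?thesis
      unfolding eq V(3)[symmetric] using range_from_nat_into[OF False V(2)] by simp
  qed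
qed

definition bound :: real where "bound = (SUP S\<in>sets borel. norm (E S))"

text \<open>Each orbit \<open>S \<mapsto> E S x\<close> is a vector measure, hence bounded; the uniform boundedness principle
  then bounds the projections in operator norm.\<close>

lemma norm_E_le: "S \<in> sets borel \<Longrightarrow> norm (E S) \<le> bound"
proof -
  have "\<exists>B. \<forall>S\<in>sets borel. norm (E S x) \<le> B" for x
  proof (rule vector_measure_bounded)
    show "sigma_algebra UNIV (sets (borel :: complex measure))"
      using sets.sigma_algebra_axioms[of "borel :: complex measure"] by simp
  qed (auto intro: E_Un E_sums)
  then have "\<exists>B. \<forall>T\<in>E ` sets borel. norm (T x) \<le> B" for x by auto
  then have "\<exists>B. \<forall>T\<in>E ` sets borel. norm T \<le> B" by (rule uniform_boundedness)
  then have "bdd_above ((\<lambda>S. norm (E S)) ` sets borel)" by (auto simp: bdd_above_def)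
  then show "S \<in> sets borel \<Longrightarrow> norm (E S) \<le> bound"
    unfolding bound_def by (rule cSUP_upper2) auto
qed

lemma bound_nonneg: "bound \<ge> 0"
  using norm_E_le[of "{}"] by (simp add: E_empty)

lemma norm_E_apply_le: "S \<in> sets borel \<Longrightarrow> norm (E S x) \<le> bound * norm x"
  using norm_blinfun[of "E S" x] norm_E_le[of S] by (meson mult_right_mono norm_ge_zero order_trans)

section \<open>The integral of bounded Borel functions\<close>

abbreviation simple_int where "simple_int \<equiv> simple_spectral_integral E"

lemma simple_vimage: "simple_function borel s \<Longrightarrow> s -` A \<in> sets borel"
  for s :: "complex \<Rightarrow> 'p"
  using simple_functionD(2)[of borel s A] by simp

lemma simple_range: "simple_function borel s \<Longrightarrow> finite (range s)"
  for s :: "complex \<Rightarrow> 'p"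
  using simple_functionD(1)[of borel s] by simp

lemma simple_int_apply: "simple_int s x = (\<Sum>c\<in>range s. c *\<^sub>C E (s -` {c}) x)"
  by (simp add: simple_spectral_integral_def blinfun.sum_left scaleC_op_apply)

text \<open>The defining sum runs over the values of the function. Rewriting it over the fibres of an
  arbitrary simple \<open>p\<close> allows two simple functions to be compared on the common partition given by
  pairs.\<close>

lemma simple_int_partition:
  fixes p :: "complex \<Rightarrow> 'p"
  assumes p: "simple_function borel p"
  shows "simple_int (\<lambda>z. h (p z)) x = (\<Sum>d\<in>range p. h d *\<^sub>C E (p -` {d}) x)"
proof -
  have fin: "finite (range p)" by (rule simple_range[OF p])
  have *: "c *\<^sub>C E ((\<lambda>z. h (p z)) -` {c}) x = (\<Sum>d\<in>{d. d \<in> range p \<and> h d = c}. h d *\<^sub>C E (p -` {d}) x)" for c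
  proof -
    let ?D = "{d. d \<in> range p \<and> h d = c}"
    have "(\<lambda>z. h (p z)) -` {c} = (\<Union>d\<in>?D. p -` {d})" by auto
    moreover have "E (\<Union>d\<in>?D. p -` {d}) x = (\<Sum>d\<in>?D. E (p -` {d}) x)"
      using fin by (intro E_UN_finite simple_vimage[OF p]) (auto simp: disjoint_family_on_def)
    ultimately show ?thesis by (simp add: scaleC_sum_right)
  qed
  have "simple_int (\<lambda>z. h (p z)) x = (\<Sum>c\<in>h ` range p. c *\<^sub>C E ((\<lambda>z. h (p z)) -` {c}) x)"
    by (simp add: simple_int_apply image_image)
  also have "\<dots> = (\<Sum>d\<in>range p. h d *\<^sub>C E (p -` {d}) x)"
    unfolding * by (rule sum.image_gen[OF fin, symmetric])
  finally show ?thesis .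
qed

lemma simple_int_add:
  assumes "simple_function borel s" "simple_function borel r"
  shows "simple_int (\<lambda>z. s z + r z) = simple_int s + simple_int r"
proof (rule blinfun_eqI)
  fix x
  have p: "simple_function borel (\<lambda>z. (s z, r z))" using assms by auto
  have "simple_int (\<lambda>z. s z) x = (\<Sum>d\<in>range (\<lambda>z. (s z, r z)). fst d *\<^sub>C E ((\<lambda>z. (s z, r z)) -` {d}) x)"
    using simple_int_partition[OF p, of fst x] by simp
  moreover have "simple_int (\<lambda>z. r z) x = (\<Sum>d\<in>range (\<lambda>z. (s z, r z)). snd d *\<^sub>C E ((\<lambda>z. (s z, r z)) -` {d}) x)"
    using simple_int_partition[OF p, of snd x] by simp
  ultimately show "simple_int (\<lambda>z. s z + r z) x = (simple_int s + simple_int r) x"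
    using simple_int_partition[OF p, of "\<lambda>d. fst d + snd d" x]
    by (simp add: blinfun.add_left sum.distrib scaleC_add_left)
qed

lemma simple_int_mult:
  assumes s: "simple_function borel s" and r: "simple_function borel r"
  shows "simple_int (\<lambda>z. s z * r z) = simple_int s o\<^sub>L simple_int r"
proof (rule blinfun_eqI)
  fix x
  let ?p = "\<lambda>z. (s z, r z)"
  have p: "simple_function borel ?p" using assms by auto
  have "simple_int s (simple_int r x) = (\<Sum>c\<in>range s. \<Sum>d\<in>range r. (c * d) *\<^sub>C E (?p -` {(c, d)}) x)"
    unfolding simple_int_apply
  proof (intro sum.cong refl)
    fix c
    have "s -` {c} \<inter> r -` {d} = ?p -` {(c, d)}" for d by auto
    then show "c *\<^sub>C E (s -` {c}) (\<Sum>d\<in>range r. d *\<^sub>C E (r -` {d}) x) =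
      (\<Sum>d\<in>range r. (c * d) *\<^sub>C E (?p -` {(c, d)}) x)"
      by (simp add: blinfun.sum_right scaleC_sum_right E_scaleC simple_vimage[OF s] simple_vimage[OF r] E_Int scaleC_scaleC)
  qed
  also have "\<dots> = (\<Sum>d\<in>range s \<times> range r. (fst d * snd d) *\<^sub>C E (?p -` {d}) x)"
    by (simp add: sum.cartesian_product case_prod_unfold)
  also have "\<dots> = (\<Sum>d\<in>range ?p. (fst d * snd d) *\<^sub>C E (?p -` {d}) x)"
  proof (rule sum.mono_neutral_right)
    show "finite (range s \<times> range r)" using simple_range[OF s] simple_range[OF r] by simp
    show "range ?p \<subseteq> range s \<times> range r" by auto
    have "?p -` {d} = {}" if "d \<notin> range ?p" for d using that by auto
    then show "\<forall>d\<in>range s \<times> range r - range ?p. (fst d * snd d) *\<^sub>C E (?p -` {d}) x = 0"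
      by (simp add: E_empty)
  qed
  also have "\<dots> = simple_int (\<lambda>z. s z * r z) x" using simple_int_partition[OF p, of "\<lambda>d. fst d * snd d" x] by simp
  finally show "simple_int (\<lambda>z. s z * r z) x = (simple_int s o\<^sub>L simple_int r) x" by simp
qed

lemma simple_int_const: "simple_int (\<lambda>_. c) = scaleC_op c"
  by (rule blinfun_eqI) (simp add: simple_int_apply scaleC_op_apply E_UNIV)

lemma weighted_sum_bound:
  fixes w :: "complex \<Rightarrow> real"
  assumes s: "simple_function borel s" and w: "\<And>d. d \<in> range s \<Longrightarrow> 0 \<le> w d \<and> w d \<le> b"
  shows "norm (\<Sum>d\<in>range s. w d *\<^sub>R E (s -` {d}) x) \<le> b * (bound * norm x)"
proof -
  have b: "b \<ge> 0" using w[of "s 0"] by auto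
  show ?thesis
  proof (cases "b = 0")
    case True
    then have "w d = 0" if "d \<in> range s" for d using w[OF that] by simp
    then show ?thesis using b True by simp
  next
    case False
    have "norm (0 + (\<Sum>d\<in>range s. (w d / b) *\<^sub>R E (s -` {d}) x)) \<le> bound * norm x"
    proof (rule convex_coefficients_bound)
      show "finite (range s)" by (rule simple_range[OF s])
      fix J assume J: "J \<subseteq> range s"
      then have "finite J" using simple_range[OF s] finite_subset by blast
      then have "(\<Sum>d\<in>J. E (s -` {d}) x) = E (\<Union>d\<in>J. s -` {d}) x"
        by (intro E_UN_finite[symmetric] simple_vimage[OF s]) (auto simp: disjoint_family_on_def)
      also have "norm \<dots> \<le> bound * norm x"
        using \<open>finite J\<close> by (intro norm_E_apply_le sets.finite_UN simple_vimage[OF s])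
      finally show "norm (0 + (\<Sum>d\<in>J. E (s -` {d}) x)) \<le> bound * norm x" by simp
    qed (use w b False in auto)
    moreover have "(\<Sum>d\<in>range s. w d *\<^sub>R E (s -` {d}) x) = b *\<^sub>R (\<Sum>d\<in>range s. (w d / b) *\<^sub>R E (s -` {d}) x)"
      using False by (simp add: scaleR_sum_right)
    ultimately show ?thesis using b by (simp add: mult_left_mono)
  qed
qed

text \<open>Coefficients in \<open>[0, b]\<close> cost at most \<open>b\<close> times the bound of the projections. A complex
  coefficient is a combination of four such ones, the positive and negative parts of its real and
  imaginary part, whence the factor \<open>4\<close>.\<close>

lemma simple_int_norm:
  assumes s: "simple_function borel s" and b: "\<And>z. cmod (s z) \<le> b"
  shows "norm (simple_int s) \<le> 4 * bound * b"
proof (rule norm_blinfun_bound)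
  have b0: "b \<ge> 0" using b[of 0] norm_ge_zero order_trans by blast
  then show "0 \<le> 4 * bound * b" using bound_nonneg by simp
  fix x
  let ?v = "\<lambda>d. E (s -` {d}) x"
  let ?S = "\<lambda>w. \<Sum>d\<in>range s. w d *\<^sub>R ?v d"
  have bb: "\<bar>Re d\<bar> \<le> b" "\<bar>Im d\<bar> \<le> b" if "d \<in> range s" for d
    using that b abs_Re_le_cmod abs_Im_le_cmod by (auto intro: order_trans)
  have m: "0 \<le> max 0 r \<and> max 0 r \<le> b" if "\<bar>r\<bar> \<le> b" for r using that by auto
  have n: "norm (?S (\<lambda>d. max 0 (Re d))) \<le> b * (bound * norm x)"
    "norm (?S (\<lambda>d. max 0 (- Re d))) \<le> b * (bound * norm x)"
    "norm (?S (\<lambda>d. max 0 (Im d))) \<le> b * (bound * norm x)"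
    "norm (?S (\<lambda>d. max 0 (- Im d))) \<le> b * (bound * norm x)"
    using weighted_sum_bound[OF s m[OF bb(1)]] weighted_sum_bound[OF s m[OF bb(2)]]
      weighted_sum_bound[OF s m, of "\<lambda>d. - Re d"] weighted_sum_bound[OF s m, of "\<lambda>d. - Im d"] bb
    by auto
  have c: "d *\<^sub>C y = (max 0 (Re d) *\<^sub>R y - max 0 (- Re d) *\<^sub>R y) +
     \<i> *\<^sub>C (max 0 (Im d) *\<^sub>R y - max 0 (- Im d) *\<^sub>R y)" for d y
  proof -
    have "max 0 (Re d) *\<^sub>R y - max 0 (- Re d) *\<^sub>R y = Re d *\<^sub>R y"
      "max 0 (Im d) *\<^sub>R y - max 0 (- Im d) *\<^sub>R y = Im d *\<^sub>R y"
      by (auto simp: max_def simp flip: scaleR_diff_left)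
    moreover have "d *\<^sub>C y = complex_of_real (Re d) *\<^sub>C y + (\<i> * complex_of_real (Im d)) *\<^sub>C y"
      by (metis complex_eq scaleC_add_left)
    ultimately show ?thesis by (simp only: scaleR_scaleC scaleC_scaleC)
  qed
  have eq: "simple_int s x = (?S (\<lambda>d. max 0 (Re d)) - ?S (\<lambda>d. max 0 (- Re d))) +
     \<i> *\<^sub>C (?S (\<lambda>d. max 0 (Im d)) - ?S (\<lambda>d. max 0 (- Im d)))"
    unfolding simple_int_apply sum_subtractf[symmetric] scaleC_sum_right sum.distrib[symmetric]
    by (intro sum.cong refl c)
  have "norm ((p1 - p2) + \<i> *\<^sub>C (p3 - p4)) \<le> (norm p1 + norm p2) + (norm p3 + norm p4)"
    for p1 p2 p3 p4 :: 'a
    using norm_triangle_ineq[of "p1 - p2" "\<i> *\<^sub>C (p3 - p4)"] norm_triangle_ineq4[of p1 p2]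
      norm_triangle_ineq4[of p3 p4] by (simp add: norm_scaleC)
  from order_trans[OF this add_mono[OF add_mono[OF n(1,2)] add_mono[OF n(3,4)]]]
  show "norm (simple_int s x) \<le> 4 * bound * b * norm x"
    unfolding eq by (simp add: algebra_simps)
qed

lemma simple_int_diff:
  assumes "simple_function borel s" "simple_function borel r"
  shows "simple_int (\<lambda>z. s z - r z) = simple_int s - simple_int r"
proof -
  have "simple_function borel (\<lambda>z. s z - r z)" using assms by auto
  from simple_int_add[OF this assms(2)] show ?thesis by (simp add: algebra_simps)
qed

lemma spectral_integral_bounded:
  assumes "has_spectral_integral E f T"
  shows "bounded (range f)"
proof -
  obtain s where s: "\<And>n. simple_function borel (s n)" "uniform_limit UNIV s f sequentially"
    using assms unfolding has_spectral_integral_def by blast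
  obtain n where n: "\<And>x. dist (s n x) (f x) < 1"
    using eventually_happens[OF uniform_limitD[OF s(2), of 1]] by auto
  have "bounded (range (s n))" using simple_range[OF s(1)] finite_imp_bounded by blast
  then obtain B where "\<And>x. norm (s n x) \<le> B" by (auto simp: bounded_iff)
  then have "norm (f x) \<le> B + 1" for x
    using n[of x] norm_triangle_ineq3[of "f x" "s n x"] by (smt (verit) dist_norm norm_minus_commute)
  then show ?thesis by (auto simp: bounded_iff)
qed

lemma spectral_integral_simple: "simple_function borel s \<Longrightarrow> has_spectral_integral E s (simple_int s)"
  unfolding has_spectral_integral_def
  by (intro exI[of _ "\<lambda>_. s"]) (auto simp: uniform_limit_iff)

lemma spectral_integral_add:
  assumes "has_spectral_integral E f T" "has_spectral_integral E g U"
  shows "has_spectral_integral E (\<lambda>z. f z + g z) (T + U)"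
proof -
  obtain s where s: "\<And>n. simple_function borel (s n)" "uniform_limit UNIV s f sequentially"
    "(\<lambda>n. simple_int (s n)) \<longlonglongrightarrow> T" using assms unfolding has_spectral_integral_def by blast
  obtain r where r: "\<And>n. simple_function borel (r n)" "uniform_limit UNIV r g sequentially"
    "(\<lambda>n. simple_int (r n)) \<longlonglongrightarrow> U" using assms unfolding has_spectral_integral_def by blast
  show ?thesis unfolding has_spectral_integral_def
  proof (intro exI[of _ "\<lambda>n z. s n z + r n z"] conjI allI)
    show "uniform_limit UNIV (\<lambda>n z. s n z + r n z) (\<lambda>z. f z + g z) sequentially"
      using s r by (intro uniform_limit_add)
    show "(\<lambda>n. simple_int (\<lambda>z. s n z + r n z)) \<longlonglongrightarrow> T + U"
      using s r by (simp add: simple_int_add tendsto_add)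
  qed (use s r in auto)
qed

lemma spectral_integral_mult:
  assumes "has_spectral_integral E f T" "has_spectral_integral E g U"
  shows "has_spectral_integral E (\<lambda>z. f z * g z) (T o\<^sub>L U)"
proof -
  obtain s where s: "\<And>n. simple_function borel (s n)" "uniform_limit UNIV s f sequentially"
    "(\<lambda>n. simple_int (s n)) \<longlonglongrightarrow> T" using assms unfolding has_spectral_integral_def by blast
  obtain r where r: "\<And>n. simple_function borel (r n)" "uniform_limit UNIV r g sequentially"
    "(\<lambda>n. simple_int (r n)) \<longlonglongrightarrow> U" using assms unfolding has_spectral_integral_def by blast
  show ?thesis unfolding has_spectral_integral_def
  proof (intro exI[of _ "\<lambda>n z. s n z * r n z"] conjI allI)
    show "uniform_limit UNIV (\<lambda>n z. s n z * r n z) (\<lambda>z. f z * g z) sequentially"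
      using s r spectral_integral_bounded[OF assms(1)] spectral_integral_bounded[OF assms(2)] by (intro uniform_lim_mult)
    show "(\<lambda>n. simple_int (\<lambda>z. s n z * r n z)) \<longlonglongrightarrow> (T o\<^sub>L U)"
      using s r by (simp add: simple_int_mult bounded_bilinear.tendsto[OF bounded_bilinear_blinfun_compose])
  qed (use s r in auto)
qed

lemma spectral_integral_norm:
  assumes "has_spectral_integral E f T" and b: "\<And>z. cmod (f z) \<le> b"
  shows "norm T \<le> 4 * bound * b"
proof -
  obtain s where s: "\<And>n. simple_function borel (s n)" "uniform_limit UNIV s f sequentially"
    "(\<lambda>n. simple_int (s n)) \<longlonglongrightarrow> T" using assms unfolding has_spectral_integral_def by blast
  have *: "norm T \<le> 4 * bound * (b + e)" if e: "e > 0" for e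
  proof (rule tendsto_upperbound)
    show "(\<lambda>n. norm (simple_int (s n))) \<longlonglongrightarrow> norm T" using s(3) by (rule tendsto_norm)
    show "\<forall>\<^sub>F n in sequentially. norm (simple_int (s n)) \<le> 4 * bound * (b + e)"
      using uniform_limitD[OF s(2) e]
    proof (rule eventually_mono)
      fix n assume d: "\<forall>z\<in>UNIV. dist (s n z) (f z) < e"
      have "cmod (s n z) \<le> b + e" for z
        using d[rule_format, of z] b[of z] norm_triangle_ineq2[of "s n z" "f z"] by (auto simp: dist_norm)
      then show "norm (simple_int (s n)) \<le> 4 * bound * (b + e)" by (rule simple_int_norm[OF s(1)])
    qed
  qed auto
  have "((\<lambda>e. 4 * bound * (b + e)) \<longlongrightarrow> 4 * bound * (b + 0)) (at_right 0)"
    by (intro tendsto_intros)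
  then have "norm T \<le> 4 * bound * (b + 0)"
    by (rule tendsto_lowerbound) (use * in \<open>auto simp: eventually_at_right_less eventually_at_filter\<close>)
  then show ?thesis by simp
qed

lemma spectral_integral_diff:
  assumes "has_spectral_integral E f T" "has_spectral_integral E g U"
  shows "has_spectral_integral E (\<lambda>z. f z - g z) (T - U)"
proof -
  have "has_spectral_integral E (\<lambda>_. -1) (simple_int (\<lambda>_. -1))" by (rule spectral_integral_simple) simp
  from spectral_integral_add[OF assms(1) spectral_integral_mult[OF this assms(2)]]
  have "has_spectral_integral E (\<lambda>z. f z - g z) (T + (simple_int (\<lambda>_. -1) o\<^sub>L U))" by simp
  moreover have "simple_int (\<lambda>_. -1) o\<^sub>L U = - U"
    unfolding simple_int_const
    by (intro blinfun_eqI) (simp add: scaleC_op_apply blinfun.minus_left)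
  ultimately show ?thesis by simp
qed

lemma spectral_integral_unique:
  assumes "has_spectral_integral E f T" "has_spectral_integral E f U"
  shows "T = U"
  using spectral_integral_norm[OF spectral_integral_diff[OF assms], of 0] by simp

text \<open>Rounding the real and imaginary parts down to multiples of \<open>1 / (n + 1)\<close> approximates \<open>f\<close>
  uniformly by simple functions, and the norm bound makes their integrals a Cauchy sequence.\<close>

lemma spectral_integral_exists:
  assumes "bounded_borel f"
  shows "\<exists>T. has_spectral_integral E f T"
proof -
  have f[measurable]: "f \<in> borel_measurable borel" and "bounded (range f)"
    using assms by (auto simp: bounded_borel_def)
  then obtain B where B: "\<And>z. cmod (f z) \<le> B" by (auto simp: bounded_iff)
  define q where "q n x = of_int \<lfloor>x * real (Suc n)\<rfloor> / real (Suc n)" for n and x :: real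
  define s where "s n z = Complex (q n (Re (f z))) (q n (Im (f z)))" for n z
  have q: "\<bar>q n x - x\<bar> \<le> 1 / real (Suc n)" for n x
  proof -
    have "\<bar>q n x - x\<bar> * real (Suc n) = \<bar>of_int \<lfloor>x * real (Suc n)\<rfloor> - x * real (Suc n)\<bar>"
      unfolding q_def by (subst (2) abs_of_nonneg[symmetric]) (simp_all add: field_simps flip: abs_mult)
    also have "\<dots> \<le> 1" by linarith
    finally show ?thesis by (simp add: field_simps)
  qed
  have sf: "cmod (s n z - f z) \<le> 2 / real (Suc n)" for n z
  proof -
    have "cmod (s n z - f z) \<le> \<bar>Re (s n z - f z)\<bar> + \<bar>Im (s n z - f z)\<bar>" by (rule cmod_le)
    then show ?thesis using q[of n "Re (f z)"] q[of n "Im (f z)"] by (simp add: s_def)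
  qed
  have simple: "simple_function borel (s n)" for n
  proof -
    let ?J = "{\<lfloor>- B * real (Suc n)\<rfloor>..\<lfloor>B * real (Suc n)\<rfloor>}"
    have J: "\<lfloor>x * real (Suc n)\<rfloor> \<in> ?J" if "\<bar>x\<bar> \<le> B" for x
      using mult_right_mono[of "- B" x "real (Suc n)"] mult_right_mono[of x B "real (Suc n)"] that
      by (auto intro!: floor_mono)
    have "finite (range (s n))"
    proof (rule finite_subset)
      show "range (s n) \<subseteq> (\<lambda>(i, j). Complex (of_int i / real (Suc n)) (of_int j / real (Suc n))) ` (?J \<times> ?J)"
      proof (rule image_subsetI)
        fix z
        have "\<bar>Re (f z)\<bar> \<le> B" "\<bar>Im (f z)\<bar> \<le> B"
          using B[of z] abs_Re_le_cmod[of "f z"] abs_Im_le_cmod[of "f z"] by auto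
        then have "(\<lfloor>Re (f z) * real (Suc n)\<rfloor>, \<lfloor>Im (f z) * real (Suc n)\<rfloor>) \<in> ?J \<times> ?J"
          using J by blast
        then show "s n z \<in> (\<lambda>(i, j). Complex (of_int i / real (Suc n)) (of_int j / real (Suc n))) ` (?J \<times> ?J)"
          by (rule rev_image_eqI) (simp add: s_def q_def)
      qed
    qed simp
    moreover have "s n \<in> borel_measurable borel"
      unfolding s_def q_def borel_measurable_complex_iff by simp
    ultimately show ?thesis by (simp add: simple_function_borel_measurable)
  qed
  have lim0: "(\<lambda>n. c / real (Suc n)) \<longlonglongrightarrow> 0" for c
    using tendsto_mult_right_zero[OF LIMSEQ_inverse_real_of_nat, of c] by (simp add: divide_inverse)
  have "uniform_limit UNIV s f sequentially"
  proof (rule uniform_limitI)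
    fix e :: real assume "e > 0"
    then have "\<forall>\<^sub>F n in sequentially. 2 / real (Suc n) < e" using order_tendstoD(2)[OF lim0] by blast
    then show "\<forall>\<^sub>F n in sequentially. \<forall>z\<in>UNIV. dist (s n z) (f z) < e"
      by (rule eventually_mono) (use sf in \<open>auto simp: dist_norm intro: le_less_trans\<close>)
  qed
  moreover have "Cauchy (\<lambda>n. simple_int (s n))"
  proof (rule metric_CauchyI)
    fix e :: real assume "e > 0"
    then have "\<forall>\<^sub>F n in sequentially. (4 * bound * 4) / real (Suc n) < e"
      using order_tendstoD(2)[OF lim0] by blast
    then obtain N where N: "(4 * bound * 4) / real (Suc N) < e" by (auto simp: eventually_sequentially)
    have "dist (simple_int (s m)) (simple_int (s n)) < e" if "m \<ge> N" "n \<ge> N" for m n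
    proof -
      have "cmod (s m z - s n z) \<le> 4 / real (Suc N)" for z
      proof -
        have "cmod (s m z - s n z) \<le> cmod (s m z - f z) + cmod (s n z - f z)"
          using norm_triangle_ineq4[of "s m z - f z" "s n z - f z"] by simp
        also have "\<dots> \<le> 2 / real (Suc m) + 2 / real (Suc n)" using sf by (intro add_mono)
        also have "\<dots> \<le> 2 / real (Suc N) + 2 / real (Suc N)"
          using that by (intro add_mono divide_left_mono) auto
        finally show ?thesis by simp
      qed
      then have "norm (simple_int (\<lambda>z. s m z - s n z)) \<le> 4 * bound * (4 / real (Suc N))"
        using simple by (intro simple_int_norm) auto
      then show ?thesis using N simple by (simp add: dist_norm simple_int_diff)
    qed
    then show "\<exists>M. \<forall>m\<ge>M. \<forall>n\<ge>M. dist (simple_int (s m)) (simple_int (s n)) < e" by blast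
  qed
  then obtain T where "(\<lambda>n. simple_int (s n)) \<longlonglongrightarrow> T" using Cauchy_convergent convergent_def by blast
  ultimately show ?thesis using simple unfolding has_spectral_integral_def by blast
qed

end

lemma has_vector_derivative_shift:
  assumes "(f has_vector_derivative d) (at (t + s))"
  shows "((\<lambda>t. f (t + s)) has_vector_derivative d) (at t)"
proof -
  have "((\<lambda>t. t + s) has_vector_derivative 1) (at t)"
    by (auto intro!: derivative_eq_intros simp: has_vector_derivative_def)
  from vector_diff_chain_at[OF this, of f d] assms show ?thesis by (simp add: o_def)
qed

lemma has_vector_derivative_uminus_arg:
  assumes "(f has_vector_derivative d) (at (- t))"
  shows "((\<lambda>t. f (- t)) has_vector_derivative - d) (at (t::real))"
proof -
  have "((\<lambda>t::real. - t) has_vector_derivative -1) (at t)"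
    by (auto intro!: derivative_eq_intros simp: has_vector_derivative_def)
  from vector_diff_chain_at[OF this, of f d] assms show ?thesis by (simp add: o_def)
qed

lemma bounded_borel_mult: "bounded_borel f \<Longrightarrow> bounded_borel g \<Longrightarrow> bounded_borel (\<lambda>z. f z * g z)"
proof -
  assume "bounded_borel f" "bounded_borel g"
  then obtain a b where "f \<in> borel_measurable borel" "g \<in> borel_measurable borel"
    and ab: "\<And>z. cmod (f z) \<le> a" "\<And>z. cmod (g z) \<le> b"
    unfolding bounded_borel_def bounded_iff by auto
  moreover have "cmod (f z * g z) \<le> a * b" for z
    unfolding norm_mult using ab[of z] by (meson mult_mono norm_ge_zero order_trans)
  ultimately show ?thesis unfolding bounded_borel_def bounded_iff by auto
qed

lemma bounded_borel_diff: "bounded_borel f \<Longrightarrow> bounded_borel g \<Longrightarrow> bounded_borel (\<lambda>z. f z - g z)"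
  unfolding bounded_borel_def by (auto intro: bounded_minus_comp)

lemma bounded_borel_indicator: "S \<in> sets borel \<Longrightarrow> bounded_borel (indicator S)"
  unfolding bounded_borel_def bounded_iff by (auto intro!: exI[of _ 1] simp: indicator_def)

lemma bounded_borel_cutoff:
  assumes S: "S \<in> sets borel" and h: "continuous_on UNIV h" and b: "\<And>z. z \<in> S \<Longrightarrow> cmod (h z) \<le> b"
  shows "bounded_borel (\<lambda>z. indicator S z * h z)"
proof -
  have "cmod (indicator S z * h z) \<le> max b 0" for z using b[of z] by (auto simp: indicator_def)
  moreover have "h \<in> borel_measurable borel" using h by (rule borel_measurable_continuous_onI)
  ultimately show ?thesis using S unfolding bounded_borel_def bounded_iff by auto
qed

lemma bounded_borel_cutoff_bounded:
  assumes "S \<in> sets borel" "bounded S" and h: "continuous_on UNIV h"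
  shows "bounded_borel (\<lambda>z. indicator S z * h z)"
proof -
  have "compact (h ` closure S)"
    using assms by (intro compact_continuous_image) (auto simp: compact_closure intro: continuous_on_subset)
  then obtain b where "\<And>z. z \<in> closure S \<Longrightarrow> cmod (h z) \<le> b"
    using compact_imp_bounded[of "h ` closure S"] by (auto simp: bounded_iff)
  then show ?thesis using closure_subset by (intro bounded_borel_cutoff assms) blast
qed

context spectral_calculus
begin

definition \<Phi> :: "(complex \<Rightarrow> complex) \<Rightarrow> ('a \<Rightarrow>\<^sub>L 'a)" where
  "\<Phi> f = (THE T. has_spectral_integral E f T)"

lemma calc_eq: "has_spectral_integral E f T \<Longrightarrow> \<Phi> f = T"
  unfolding \<Phi>_def using spectral_integral_unique by blast

lemma calc_integral: "bounded_borel f \<Longrightarrow> has_spectral_integral E f (\<Phi> f)"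
  using spectral_integral_exists calc_eq by blast

lemma calc_diff: "bounded_borel f \<Longrightarrow> bounded_borel g \<Longrightarrow> \<Phi> (\<lambda>z. f z - g z) = \<Phi> f - \<Phi> g"
  by (intro calc_eq spectral_integral_diff calc_integral)

lemma calc_mult: "bounded_borel f \<Longrightarrow> bounded_borel g \<Longrightarrow> \<Phi> (\<lambda>z. f z * g z) = \<Phi> f o\<^sub>L \<Phi> g"
  by (intro calc_eq spectral_integral_mult calc_integral)

lemma calc_mult_apply: "bounded_borel f \<Longrightarrow> bounded_borel g \<Longrightarrow> \<Phi> f (\<Phi> g x) = \<Phi> (\<lambda>z. f z * g z) x"
  by (simp add: calc_mult)

lemma calc_commute: "bounded_borel f \<Longrightarrow> bounded_borel g \<Longrightarrow> \<Phi> f (\<Phi> g x) = \<Phi> g (\<Phi> f x)"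
  by (simp add: calc_mult_apply mult.commute)

lemma calc_norm: "bounded_borel f \<Longrightarrow> (\<And>z. cmod (f z) \<le> b) \<Longrightarrow> norm (\<Phi> f) \<le> 4 * bound * b"
  using spectral_integral_norm calc_integral by blast

lemma calc_const: "\<Phi> (\<lambda>_. c) = scaleC_op c"
  using calc_eq[OF spectral_integral_simple[of "\<lambda>_. c"]] by (simp add: simple_int_const)

lemma calc_scaleC: assumes f: "bounded_borel f" shows "\<Phi> f (c *\<^sub>C x) = c *\<^sub>C \<Phi> f x"
proof -
  have "bounded_borel (\<lambda>_. c)" by (simp add: bounded_borel_def)
  from calc_commute[OF f this, of x] show ?thesis by (simp add: calc_const scaleC_op_apply)
qed

lemma calc_scaleR: assumes f: "bounded_borel f" shows "\<Phi> (\<lambda>z. of_real r * f z) = r *\<^sub>R \<Phi> f"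
proof -
  have "bounded_borel (\<lambda>_. of_real r)" by (simp add: bounded_borel_def)
  from calc_mult[OF this f] show ?thesis
    by (intro blinfun_eqI) (simp add: calc_const scaleC_op_apply blinfun.scaleR_left scaleR_scaleC)
qed

lemma calc_indicator: assumes S: "S \<in> sets borel" shows "\<Phi> (indicator S) = E S"
proof -
  have p: "simple_function borel (indicator S :: complex \<Rightarrow> complex)" using S by auto
  have pS: "simple_function borel (\<lambda>z. z \<in> S)"
  proof -
    have "(\<lambda>z. z \<in> S) -` {b} = (if b then S else - S)" for b by auto
    then show ?thesis using S unfolding simple_function_def by auto
  qed
  have "simple_int (indicator S) x = E S x" for x
  proof -
    have "indicator S = (\<lambda>z. (if z \<in> S then 1 else 0) :: complex)" by (auto simp: indicator_def)
    then have "simple_int (indicator S) x = (\<Sum>b\<in>range (\<lambda>z. z \<in> S). (if b then 1 else 0) *\<^sub>C E ((\<lambda>z. z \<in> S) -` {b}) x)"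
      using simple_int_partition[OF pS, of "\<lambda>b. if b then 1 else 0" x] by simp
    also have "\<dots> = (\<Sum>b\<in>{True, False}. (if b then 1 else 0) *\<^sub>C E ((\<lambda>z. z \<in> S) -` {b}) x)"
    proof (rule sum.mono_neutral_left)
      have "(\<lambda>z. z \<in> S) -` {b} = {}" if "b \<notin> range (\<lambda>z. z \<in> S)" for b using that by auto
      then show "\<forall>b\<in>{True, False} - range (\<lambda>z. z \<in> S). (if b then 1 else 0) *\<^sub>C E ((\<lambda>z. z \<in> S) -` {b}) x = 0"
        by (auto simp: E_empty)
    qed auto
    also have "\<dots> = E S x" by (simp add: vimage_def)
    finally show ?thesis .
  qed
  then have "simple_int (indicator S) = E S" by (intro blinfun_eqI)
  then show ?thesis using calc_eq[OF spectral_integral_simple[OF p]] by simp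
qed

lemma calc_restrict:
  "S \<in> sets borel \<Longrightarrow> bounded_borel f \<Longrightarrow> E S (\<Phi> f x) = \<Phi> (\<lambda>z. indicator S z * f z) x"
  by (simp add: calc_mult_apply bounded_borel_indicator flip: calc_indicator)

section \<open>The exponential on bounded parts of the spectrum\<close>

text \<open>The part of the operator \<open>\<integral> z dE\<close> on the spectral subspace of a bounded set \<open>S\<close>, and the
  group that it generates there; both vanish on the complementary subspace.\<close>

definition gen :: "complex set \<Rightarrow> ('a \<Rightarrow>\<^sub>L 'a)" where
  "gen S = \<Phi> (\<lambda>z. indicator S z * z)"

definition expo :: "complex set \<Rightarrow> real \<Rightarrow> ('a \<Rightarrow>\<^sub>L 'a)" where
  "expo S t = \<Phi> (\<lambda>z. indicator S z * exp (of_real t * z))"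

lemma bounded_borel_id: "S \<in> sets borel \<Longrightarrow> bounded S \<Longrightarrow> bounded_borel (\<lambda>z. indicator S z * z)"
  by (intro bounded_borel_cutoff_bounded continuous_intros)

lemma bounded_borel_exp:
  "S \<in> sets borel \<Longrightarrow> bounded S \<Longrightarrow> bounded_borel (\<lambda>z. indicator S z * exp (of_real t * z))"
  by (intro bounded_borel_cutoff_bounded continuous_intros)

lemma expo_zero: "S \<in> sets borel \<Longrightarrow> expo S 0 = E S"
  by (simp add: expo_def flip: calc_indicator)

lemma E_gen:
  assumes "S \<in> sets borel" "bounded S" "T \<in> sets borel"
  shows "E T (gen S x) = gen (T \<inter> S) x"
  unfolding gen_def calc_restrict[OF assms(3) bounded_borel_id[OF assms(1,2)]]
  by (rule arg_cong[of _ _ "\<lambda>f. \<Phi> f x"]) (auto simp: indicator_def)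

lemma E_expo:
  assumes "S \<in> sets borel" "bounded S" "T \<in> sets borel"
  shows "E T (expo S t x) = expo (T \<inter> S) t x"
  unfolding expo_def calc_restrict[OF assms(3) bounded_borel_exp[OF assms(1,2)]]
  by (rule arg_cong[of _ _ "\<lambda>f. \<Phi> f x"]) (auto simp: indicator_def)

lemma gen_E:
  assumes "S \<in> sets borel" "bounded S" "T \<in> sets borel"
  shows "gen S (E T x) = gen (T \<inter> S) x"
  using calc_commute[OF bounded_borel_id[OF assms(1,2)] bounded_borel_indicator[OF assms(3)], of x]
    E_gen[OF assms] assms by (simp add: calc_indicator gen_def)

lemma expo_E:
  assumes "S \<in> sets borel" "bounded S" "T \<in> sets borel"
  shows "expo S t (E T x) = expo (T \<inter> S) t x"
  using calc_commute[OF bounded_borel_exp[OF assms(1,2)] bounded_borel_indicator[OF assms(3)], of t x]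
    E_expo[OF assms] assms by (simp add: calc_indicator expo_def)

text \<open>The remainder \<open>e\<^bsup>tz\<^esup> (e\<^bsup>hz\<^esup> - 1 - hz)\<close> is \<open>O(h\<^sup>2)\<close> uniformly on the bounded set \<open>S\<close>, and
  the norm of a spectral integral is controlled by the supremum of its integrand.\<close>

lemma expo_has_vector_derivative:
  assumes S: "S \<in> sets borel" "bounded S"
  shows "(expo S has_vector_derivative (gen S o\<^sub>L expo S t)) (at t)"
proof -
  obtain R where R: "R > 0" "\<And>z. z \<in> S \<Longrightarrow> cmod z \<le> R" using S(2) bounded_pos by blast
  note b = bounded_borel_exp[OF S] and bi = bounded_borel_id[OF S]
  show ?thesis
  proof (rule has_vector_derivative_quadratic)
    fix h :: real assume h: "\<bar>h\<bar> \<le> 1"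
    let ?f = "\<lambda>z. (indicator S z * exp (of_real (t + h) * z) - indicator S z * exp (of_real t * z)) -
       of_real h * ((indicator S z * z) * (indicator S z * exp (of_real t * z)))"
    have bb: "bounded_borel (\<lambda>z. (indicator S z * z) * (indicator S z * exp (of_real t * z)))"
      by (rule bounded_borel_mult[OF bi b])
    have bc: "bounded_borel (\<lambda>z. of_real h * f z)" if "bounded_borel f" for f
      using that by (intro bounded_borel_mult) (auto simp: bounded_borel_def)
    have eq: "expo S (t + h) - expo S t - h *\<^sub>R (gen S o\<^sub>L expo S t) = \<Phi> ?f"
      unfolding expo_def gen_def by (simp only: calc_diff calc_scaleR calc_mult b bi bb bounded_borel_diff bc)
    have "norm (\<Phi> ?f) \<le> 4 * bound * (exp (\<bar>t\<bar> * R) * (exp R * (R\<^sup>2 * h\<^sup>2)))"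
    proof (rule calc_norm)
      show "bounded_borel ?f" by (intro bounded_borel_diff bc bb b)
      fix z
      show "cmod (?f z) \<le> exp (\<bar>t\<bar> * R) * (exp R * (R\<^sup>2 * h\<^sup>2))"
      proof (cases "z \<in> S")
        case True
        have z: "cmod z \<le> R" by (rule R(2)[OF True])
        have re: "\<bar>Re z\<bar> \<le> R" using abs_Re_le_cmod[of z] z by simp
        have "?f z = exp (of_real t * z) * (exp (of_real h * z) - 1 - of_real h * z)"
          using True by (simp add: algebra_simps exp_add)
        moreover have "cmod (exp (of_real t * z)) \<le> exp (\<bar>t\<bar> * R)"
        proof -
          have "t * Re z \<le> \<bar>t\<bar> * \<bar>Re z\<bar>" by (metis abs_ge_self abs_mult)
          also have "\<dots> \<le> \<bar>t\<bar> * R" using re by (intro mult_left_mono) auto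
          finally show ?thesis by (simp add: norm_exp_eq_Re)
        qed
        moreover have "cmod (exp (of_real h * z) - 1 - of_real h * z) \<le> exp R * (R\<^sup>2 * h\<^sup>2)"
        proof -
          have "cmod (exp (of_real h * z) - 1 - of_real h * z) \<le> exp \<bar>Re (of_real h * z)\<bar> * (cmod (of_real h * z))\<^sup>2"
            using Taylor_exp[of "of_real h * z" 1] by (simp add: power2_eq_square algebra_simps)
          also have "\<dots> \<le> exp R * (R\<^sup>2 * h\<^sup>2)"
          proof (intro mult_mono)
            have "\<bar>h\<bar> * \<bar>Re z\<bar> \<le> 1 * R" using h re by (intro mult_mono) auto
            then show "exp \<bar>Re (of_real h * z)\<bar> \<le> exp R" by (simp add: abs_mult)
            have "(cmod z)\<^sup>2 \<le> R\<^sup>2" using z by (simp add: power_mono)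
            then show "(cmod (of_real h * z))\<^sup>2 \<le> R\<^sup>2 * h\<^sup>2"
              by (simp add: norm_mult power_mult_distrib mult.commute[of "h\<^sup>2"] mult_right_mono)
          qed auto
          finally show ?thesis .
        qed
        ultimately show ?thesis by (simp add: norm_mult mult_mono)
      qed auto
    qed
    then show "norm (expo S (t + h) - expo S t - h *\<^sub>R (gen S o\<^sub>L expo S t)) \<le>
        (4 * bound * (exp (\<bar>t\<bar> * R) * (exp R * R\<^sup>2))) * h\<^sup>2"
      unfolding eq by (simp add: algebra_simps)
  qed
qed

abbreviation disc :: "nat \<Rightarrow> complex set" where "disc n \<equiv> {z. cmod z \<le> real n}"

lemma disc_sets: "disc n \<in> sets borel" and disc_bounded: "bounded (disc n)"
proof -
  have "disc n = cball 0 (real n)" by auto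
  then show "disc n \<in> sets borel" "bounded (disc n)" by simp_all
qed

lemma E_disc_lim: "(\<lambda>n. E (disc n) x) \<longlonglongrightarrow> x"
proof -
  have "(\<Union>n. disc n) = UNIV" using real_arch_simple by auto
  moreover have "range disc \<subseteq> sets borel" using disc_sets by blast
  ultimately show ?thesis
    using E_incseq[of disc x] by (simp add: incseq_def E_UNIV subset_iff)
qed

lemma E_disc_separates: "(\<And>n. E (disc n) x = 0) \<Longrightarrow> x = 0"
  using E_disc_lim[of x] LIMSEQ_unique[OF tendsto_const] by fastforce

section \<open>Flows and their smoothness\<close>

text \<open>Weak solutions tested with the spectral projections of discs instead of functionals. In this
  form the class is visibly stable under translations and under operators of the functional calculus,
  and the equations hold in norm for bounded operators.\<close>

definition flow :: "(real \<Rightarrow> 'a) \<Rightarrow> bool" where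
  "flow y \<longleftrightarrow> continuous_on UNIV y \<and>
    (\<forall>n t. ((\<lambda>t. E (disc n) (y t)) has_vector_derivative gen (disc n) (y t)) (at t))"

text \<open>On a disc the equation has a bounded generator, so the usual uniqueness argument applies:
  \<open>e\<^bsup>-sT\<^esup> y(s + t)\<close> has derivative \<open>0\<close> in \<open>s\<close>.\<close>

lemma flow_expo:
  assumes y: "flow y"
  shows "expo (disc n) (- c) (y (t + c)) = E (disc n) (y t)"
proof -
  let ?D = "disc n"
  let ?G = "\<lambda>s. expo ?D (- s) (E ?D (y (s + t)))"
  have "(?G has_vector_derivative 0) (at s)" for s
  proof -
    have 1: "((\<lambda>s. expo ?D (- s)) has_vector_derivative - (gen ?D o\<^sub>L expo ?D (- s))) (at s)"
      by (rule has_vector_derivative_uminus_arg[OF expo_has_vector_derivative[OF disc_sets disc_bounded]])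
    have 2: "((\<lambda>s. E ?D (y (s + t))) has_vector_derivative gen ?D (y (s + t))) (at s)"
      by (rule has_vector_derivative_shift[of "\<lambda>s. E ?D (y s)"]) (use y in \<open>auto simp: flow_def\<close>)
    have 3: "gen ?D (expo ?D (- s) (E ?D x)) = expo ?D (- s) (gen ?D x)" for x
    proof -
      have "gen ?D (expo ?D (- s) (E ?D x)) = gen ?D (expo ?D (- s) x)"
        using expo_E[OF disc_sets disc_bounded disc_sets, of n "- s" n x] by simp
      also have "\<dots> = expo ?D (- s) (gen ?D x)"
        unfolding gen_def expo_def
        by (rule calc_commute[OF bounded_borel_id[OF disc_sets disc_bounded] bounded_borel_exp[OF disc_sets disc_bounded]])
      finally show ?thesis .
    qed
    from bounded_bilinear.has_vector_derivative[OF bounded_bilinear_blinfun_apply 1 2]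
    show ?thesis by (simp add: blinfun.minus_left 3)
  qed
  then obtain k where "\<And>s. ?G s = k"
    using has_vector_derivative_zero_constant[of UNIV ?G] by auto
  then have "?G c = k" "?G 0 = k" by blast+
  then have "?G c = ?G 0" by (rule trans[OF _ sym])
  then have "expo ?D (- c) (E ?D (y (c + t))) = E ?D (E ?D (y t))" by (simp add: expo_zero disc_sets)
  then show ?thesis
    by (simp add: expo_E disc_sets disc_bounded E_Int add.commute)
qed

lemma flow_add: "flow y \<Longrightarrow> flow w \<Longrightarrow> flow (\<lambda>t. y t + w t)"
  unfolding flow_def by (auto intro: continuous_on_add has_vector_derivative_add simp: blinfun.add_right)

text \<open>The function \<open>w\<close> represents the generator applied to the \<open>W\<close>-part of \<open>y(t)\<close>, although
  \<open>y(t)\<close> need not lie in the domain. It is the bounded operator \<open>\<integral>\<^sub>W z e\<^bsup>-kz\<^esup> dE\<close> applied to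
  \<open>y(t + k)\<close>: the translate supplies the factor \<open>e\<^bsup>kz\<^esup>\<close> that the bounded symbol lacks.\<close>

lemma smoothing:
  assumes y: "flow y" and W: "W \<in> sets borel"
    and le: "\<And>z. z \<in> W \<Longrightarrow> cmod z \<le> C * exp (k * Re z)"
  obtains w where "flow w" "\<And>n t. E (disc n) (w t) = E W (gen (disc n) (y t))"
proof
  let ?f = "\<lambda>z. indicator W z * (z * exp (of_real (- k) * z))"
  have "cmod (z * exp (of_real (- k) * z)) \<le> C" if "z \<in> W" for z
  proof -
    have "cmod z * exp (- (k * Re z)) \<le> C * exp (k * Re z) * exp (- (k * Re z))"
      using le[OF that] by (rule mult_right_mono) simp
    then show ?thesis by (simp add: norm_mult norm_exp_eq_Re mult.assoc flip: exp_add)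
  qed
  then have b: "bounded_borel ?f" using W by (intro bounded_borel_cutoff continuous_intros)
  have comm: "\<Phi> ?f (E (disc n) x) = E (disc n) (\<Phi> ?f x)" "\<Phi> ?f (gen (disc n) x) = gen (disc n) (\<Phi> ?f x)" for n x
    using calc_commute[OF b bounded_borel_indicator[OF disc_sets]]
      calc_commute[OF b bounded_borel_id[OF disc_sets disc_bounded]]
    by (simp_all add: calc_indicator disc_sets gen_def)
  define w where "w t = \<Phi> ?f (y (t + k))" for t
  show "flow w"
    unfolding flow_def
  proof (intro conjI allI)
    have "continuous_on UNIV y" using y by (simp add: flow_def)
    then have "continuous_on UNIV (\<lambda>t. y (t + k))"
      by (rule continuous_on_compose2) (auto intro!: continuous_intros)
    then show "continuous_on UNIV w" unfolding w_def by (intro continuous_intros)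
    fix n t
    have "((\<lambda>t. E (disc n) (y (t + k))) has_vector_derivative gen (disc n) (y (t + k))) (at t)"
      by (rule has_vector_derivative_shift[of "\<lambda>s. E (disc n) (y s)"]) (use y in \<open>auto simp: flow_def\<close>)
    from bounded_linear.has_vector_derivative[OF blinfun.bounded_linear_right this, of "\<Phi> ?f"]
    show "((\<lambda>t. E (disc n) (w t)) has_vector_derivative gen (disc n) (w t)) (at t)"
      unfolding w_def comm .
  qed
  show "E (disc n) (w t) = E W (gen (disc n) (y t))" for n t
  proof -
    let ?D = "disc n"
    note D = disc_sets[of n] disc_bounded[of n]
    have "E W (gen ?D (y t)) = E W (gen ?D (E ?D (y t)))" by (simp add: gen_E D)
    also have "E ?D (y t) = expo ?D (- k) (y (t + k))" by (rule flow_expo[OF y, symmetric])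
    also have "E W (gen ?D (expo ?D (- k) (y (t + k)))) =
        \<Phi> (\<lambda>z. indicator W z * ((indicator ?D z * z) * (indicator ?D z * exp (of_real (- k) * z)))) (y (t + k))"
      unfolding gen_def expo_def
      by (simp only: calc_mult_apply bounded_borel_id bounded_borel_exp bounded_borel_mult D calc_restrict W)
    also have "\<dots> = \<Phi> (\<lambda>z. indicator ?D z * ?f z) (y (t + k))"
      by (rule arg_cong[of _ _ "\<lambda>f. \<Phi> f _"]) (auto simp: indicator_def)
    also have "\<dots> = E ?D (w t)" unfolding w_def by (rule calc_restrict[OF D(1) b, symmetric])
    finally show ?thesis by simp
  qed
qed

text \<open>The spectrum is covered by a part on which the future of the solution dominates \<open>|z|\<close> and
  one on which its past does. The two smoothed pieces add up to the derivative, and the derivative is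
  again a flow, so that the step can be iterated.\<close>

lemma flow_derivative_flow:
  assumes y: "flow y" and W: "W1 \<in> sets borel" "W2 \<in> sets borel" and null: "E (- (W1 \<union> W2)) = 0"
    and le: "\<And>z. z \<in> W1 \<Longrightarrow> cmod z \<le> C * exp (c * Re z)" "\<And>z. z \<in> W2 \<Longrightarrow> cmod z \<le> C * exp (- c * Re z)"
  obtains v where "flow v" "\<And>t. (y has_vector_derivative v t) (at t)"
proof -
  obtain w1 where w1: "flow w1" "\<And>n t. E (disc n) (w1 t) = E W1 (gen (disc n) (y t))"
    using smoothing[OF y W(1) le(1)] by blast
  obtain w2 where w2: "flow w2" "\<And>n t. E (disc n) (w2 t) = E (W2 - W1) (gen (disc n) (y t))"
    using smoothing[OF y, of "W2 - W1" C "- c"] W le(2) by blast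
  define v where "v t = w1 t + w2 t" for t
  have fv: "flow v" unfolding v_def using w1 w2 by (intro flow_add)
  have part: "E W1 x + E (W2 - W1) x = x" for x
  proof -
    have "E W1 x + E (W2 - W1) x = E (W1 \<union> (W2 - W1)) x" using W by (intro E_Un[symmetric]) auto
    also have "\<dots> = E (W1 \<union> W2) x + E (- (W1 \<union> W2)) x" unfolding null by simp
    also have "\<dots> = E ((W1 \<union> W2) \<union> - (W1 \<union> W2)) x" using W by (intro E_Un[symmetric]) auto
    also have "\<dots> = x" by (simp only: Compl_partition E_UNIV id_blinfun.rep_eq)
    finally show ?thesis .
  qed
  have "E (disc n) (v t) = gen (disc n) (y t)" for n t
    by (simp add: v_def blinfun.add_right w1 w2 part)
  then have der: "((\<lambda>t. E (disc n) (y t)) has_vector_derivative E (disc n) (v t)) (at t)" for n t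
    using y by (simp add: flow_def)
  have "(y has_vector_derivative v t) (at t)" for t
  proof (rule has_vector_derivative_if_separated[of UNIV "\<lambda>n. E (disc n)"])
    show "x = 0" if "\<And>n. n \<in> UNIV \<Longrightarrow> E (disc n) x = 0" for x
      using that E_disc_separates by blast
    show "continuous_on UNIV v" using fv by (simp add: flow_def)
  qed (rule der)
  then show ?thesis using fv that by blast
qed

end

section \<open>The growth condition gives smoothness\<close>

text \<open>In the logarithmic region \<open>|Im z|\<close> is at most exponential in \<open>|Re z|\<close>, and \<open>|Re z|\<close> always
  is. The bounded rest of the set is absorbed into the constant \<open>C\<close>.\<close>

lemma covered_by_exponential_regions:
  assumes b: "bounded (\<sigma> - log_region bm bp)" and pos: "bm > 0" "bp > 0"
  obtains C c where "\<And>z. z \<in> \<sigma> \<Longrightarrow> cmod z \<le> C * exp (c * Re z) \<or> cmod z \<le> C * exp (- c * Re z)"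
proof -
  obtain R where R: "\<And>z. z \<in> \<sigma> - log_region bm bp \<Longrightarrow> cmod z \<le> R" using b by (auto simp: bounded_iff)
  define c where "c = 1 + 1 / bm + 1 / bp"
  define C where "C = max 2 R"
  have c: "c \<ge> 1" "c \<ge> 1 / bm" "c \<ge> 1 / bp" using pos by (auto simp: c_def)
  have grow: "cmod z \<le> 2 * exp (c * \<bar>Re z\<bar>)" if im: "Im z \<noteq> 0 \<Longrightarrow> ln \<bar>Im z\<bar> \<le> c * \<bar>Re z\<bar>" for z
  proof -
    have "\<bar>Re z\<bar> \<le> c * \<bar>Re z\<bar>" using c mult_right_mono[of 1 c "\<bar>Re z\<bar>"] by simp
    also have "\<dots> \<le> exp (c * \<bar>Re z\<bar>)" using exp_ge_add_one_self[of "c * \<bar>Re z\<bar>"] by linarith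
    finally have "\<bar>Re z\<bar> \<le> exp (c * \<bar>Re z\<bar>)" .
    moreover have "\<bar>Im z\<bar> \<le> exp (c * \<bar>Re z\<bar>)"
    proof (cases "Im z = 0")
      case False
      then show ?thesis using im by (metis exp_le_cancel_iff exp_ln zero_less_abs_iff)
    qed simp
    ultimately show ?thesis using cmod_le[of z] by linarith
  qed
  show ?thesis
  proof (rule that[of C c])
    fix z assume z: "z \<in> \<sigma>"
    have "cmod z \<le> C * exp (c * \<bar>Re z\<bar>)"
    proof (cases "z \<in> log_region bm bp")
      case True
      have "ln \<bar>Im z\<bar> \<le> c * \<bar>Re z\<bar>"
      proof (cases "Re z \<le> min 0 (- bm * ln \<bar>Im z\<bar>)")
        case True
        then have "ln \<bar>Im z\<bar> \<le> (1 / bm) * \<bar>Re z\<bar>" using pos by (auto simp: field_simps)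
        also have "\<dots> \<le> c * \<bar>Re z\<bar>" using c by (intro mult_right_mono) auto
        finally show ?thesis .
      next
        case False
        then have "Re z \<ge> max 0 (bp * ln \<bar>Im z\<bar>)" using \<open>z \<in> log_region bm bp\<close> by (auto simp: log_region_def)
        then have "ln \<bar>Im z\<bar> \<le> (1 / bp) * \<bar>Re z\<bar>" using pos by (auto simp: field_simps)
        also have "\<dots> \<le> c * \<bar>Re z\<bar>" using c by (intro mult_right_mono) auto
        finally show ?thesis .
      qed
      then have "cmod z \<le> 2 * exp (c * \<bar>Re z\<bar>)" by (rule grow)
      also have "\<dots> \<le> C * exp (c * \<bar>Re z\<bar>)" by (simp add: C_def)
      finally show ?thesis .
    next
      case False
      then have "cmod z \<le> C * 1" using R[of z] z by (auto simp: C_def)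
      also have "\<dots> \<le> C * exp (c * \<bar>Re z\<bar>)" using c by (intro mult_left_mono) (auto simp: C_def)
      finally show ?thesis .
    qed
    then show "cmod z \<le> C * exp (c * Re z) \<or> cmod z \<le> C * exp (- c * Re z)"
      by (cases "Re z \<ge> 0") auto
  qed
qed

locale scalar_type_operator =
  fixes D :: "'a::complex_banach set" and A :: "'a \<Rightarrow> 'a" and E :: "complex set \<Rightarrow> ('a \<Rightarrow>\<^sub>L 'a)"
  assumes st: "scalar_type_spectral D A E"
begin

sublocale spectral_calculus E
  using st by unfold_locales (auto simp: scalar_type_spectral_def)

lemma truncation_eq_gen: "spectral_integral E S (\<lambda>z. z) = gen S"
  by (simp add: spectral_integral_def gen_def \<Phi>_def)

lemma domain_iff: "x \<in> D \<longleftrightarrow> convergent (\<lambda>n. gen (disc n) x)"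
proof -
  have "D = {x. convergent (\<lambda>n::nat. spectral_integral E (disc n) (\<lambda>z. z) x)}"
    using st by (simp add: scalar_type_spectral_def)
  then show ?thesis unfolding truncation_eq_gen by blast
qed

lemma A_lim: "x \<in> D \<Longrightarrow> (\<lambda>n. gen (disc n) x) \<longlonglongrightarrow> A x"
  using st by (simp add: scalar_type_spectral_def truncation_eq_gen)

lemma eventually_subset_disc:
  assumes "bounded S" shows "\<forall>\<^sub>F n in sequentially. S \<subseteq> disc n"
proof -
  obtain R where "\<And>z. z \<in> S \<Longrightarrow> cmod z \<le> R" using assms by (auto simp: bounded_iff)
  moreover have "\<forall>\<^sub>F n in sequentially. R \<le> real n" using filterlim_real_sequentially by (auto simp: filterlim_at_top)
  ultimately show ?thesis by (auto elim!: eventually_mono intro: order_trans)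
qed

lemma bounded_part_domain:
  assumes S: "S \<in> sets borel" "bounded S"
  shows "E S x \<in> D" "A (E S x) = gen S x"
proof -
  have "\<forall>\<^sub>F n in sequentially. gen (disc n) (E S x) = gen S x"
    using eventually_subset_disc[OF S(2)]
    by (rule eventually_mono) (simp add: gen_E disc_sets disc_bounded S Int_absorb2)
  then have lim: "(\<lambda>n. gen (disc n) (E S x)) \<longlonglongrightarrow> gen S x" by (rule tendsto_eventually)
  then show "E S x \<in> D" by (auto simp: domain_iff convergent_def)
  then show "A (E S x) = gen S x" using A_lim lim LIMSEQ_unique by blast
qed

lemma E_A:
  assumes S: "S \<in> sets borel" "bounded S" and x: "x \<in> D"
  shows "E S (A x) = gen S x"
proof -
  have "(\<lambda>n. E S (gen (disc n) x)) \<longlonglongrightarrow> E S (A x)"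
    using A_lim[OF x] by (intro tendsto_intros)
  moreover have "\<forall>\<^sub>F n in sequentially. E S (gen (disc n) x) = gen S x"
    using eventually_subset_disc[OF S(2)]
    by (rule eventually_mono) (simp add: E_gen disc_sets disc_bounded S Int_absorb2)
  then have "(\<lambda>n. E S (gen (disc n) x)) \<longlonglongrightarrow> gen S x" by (rule tendsto_eventually)
  ultimately show ?thesis using LIMSEQ_unique by blast
qed

text \<open>Density of the domain determines the functional.\<close>

lemma adjoint_op_eq:
  fixes g h :: "'a \<Rightarrow>\<^sub>L complex"
  assumes h: "h \<in> dual_space" "\<And>x. x \<in> D \<Longrightarrow> g (A x) = h x"
  shows "adjoint_op D A g = h"
  unfolding adjoint_op_def
proof (rule the_equality)
  fix k assume k: "k \<in> dual_space \<and> (\<forall>x\<in>D. blinfun_apply g (A x) = k x)"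
  have "closure D = UNIV" using st unfolding scalar_type_spectral_def densely_defined_def by blast
  moreover have "closed {x. k x = h x}" by (intro closed_Collect_eq continuous_intros)
  moreover have "D \<subseteq> {x. k x = h x}" using h(2) k by auto
  ultimately have "{x. k x = h x} = UNIV" by (metis closure_minimal top.extremum_uniqueI)
  then show "k = h" by (intro blinfun_eqI) auto
qed (use h in auto)

text \<open>For a functional \<open>g\<close> the composition \<open>g \<circ> P\<^sub>n\<close> lies in the domain of the adjoint, which maps
  it to \<open>g \<circ> T\<^sub>n\<close>. Thus the weak equation is available for every \<open>g\<close> after projecting, and the functionals
  separate points.\<close>

lemma weak_solution_imp_flow:
  assumes y: "weak_solution D A y"
  shows "flow y"
  unfolding flow_def
proof (intro conjI allI)
  show c: "continuous_on UNIV y" using y by (simp add: weak_solution_def)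
  fix n t
  let ?P = "E (disc n)" and ?T = "gen (disc n)"
  show "((\<lambda>t. ?P (y t)) has_vector_derivative ?T (y t)) (at t)"
  proof (rule has_vector_derivative_if_separated[of dual_space "\<lambda>g. g"])
    show "x = 0" if "\<And>g. g \<in> dual_space \<Longrightarrow> blinfun_apply g x = 0" for x :: 'a
      using that by (rule dual_space_separates)
    show "continuous_on UNIV (\<lambda>t. ?T (y t))" using c by (intro continuous_intros)
    fix g :: "'a \<Rightarrow>\<^sub>L complex" and t assume g: "g \<in> dual_space"
    have d: "g o\<^sub>L ?P \<in> dual_space" "g o\<^sub>L ?T \<in> dual_space"
      using g calc_scaleC[OF bounded_borel_id[OF disc_sets disc_bounded]]
      by (auto simp: dual_space_def E_scaleC disc_sets gen_def)
    have gA: "(g o\<^sub>L ?P) (A x) = (g o\<^sub>L ?T) x" if "x \<in> D" for x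
      using that by (simp add: E_A disc_sets disc_bounded)
    have "g o\<^sub>L ?P \<in> adjoint_domain D A" unfolding adjoint_domain_def using d gA by blast
    then show "((\<lambda>t. g (?P (y t))) has_vector_derivative g (?T (y t))) (at t)"
      using y adjoint_op_eq[OF d(2) gA] by (auto simp: weak_solution_def)
  qed
qed

lemma smooth_if_region:
  assumes b: "bounded (spectrum D A - log_region bm bp)" and pos: "bm > 0" "bp > 0"
    and y: "weak_solution D A y"
  shows "strongly_infinitely_differentiable y"
proof -
  have supp: "spectral_support E = spectrum D A" using st by (simp add: scalar_type_spectral_def)
  obtain C c where C: "\<And>z. z \<in> spectrum D A \<Longrightarrow> cmod z \<le> C * exp (c * Re z) \<or> cmod z \<le> C * exp (- c * Re z)"
    using covered_by_exponential_regions[OF b pos] by blast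
  define W where "W k = {z. cmod z \<le> C * exp (k * Re z)}" for k
  have W: "W k \<in> sets borel" for k
  proof -
    have "closed (W k)" unfolding W_def by (intro closed_Collect_le continuous_intros)
    then show ?thesis by simp
  qed
  have sub: "- (W c \<union> W (- c)) \<subseteq> - spectral_support E" using C by (auto simp: supp W_def)
  have null: "E (- (W c \<union> W (- c))) = 0"
    by (rule E_subset_null[OF support_complement(2) sub borel_open[OF support_complement(1)]])
      (intro borel_comp sets.Un W)
  let ?d = "\<lambda>f t. vector_derivative f (at (t::real))"
  have step: "flow (?d f) \<and> (\<forall>t. f differentiable at t)" if f: "flow f" for f
  proof -
    obtain v where v: "flow v" "\<And>t. (f has_vector_derivative v t) (at t)"
      using flow_derivative_flow[OF f W W null, of C c] unfolding W_def by blast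
    have "?d f = v" using v(2) by (auto simp: vector_derivative_at)
    then show ?thesis using v differentiableI_vector by blast
  qed
  have "flow ((?d ^^ n) y)" for n
  proof (induction n)
    case (Suc n)
    then show ?case using step[OF Suc] by simp
  qed (simp add: weak_solution_imp_flow[OF y])
  then show ?thesis using step unfolding strongly_infinitely_differentiable_def by blast
qed

end

section \<open>Failure of the growth condition\<close>

lemma has_vector_derivative_uniform_limit:
  fixes u v :: "real \<Rightarrow> 'b::banach"
  assumes der: "\<And>n t. t \<in> {a<..<b} \<Longrightarrow> (U n has_vector_derivative V n t) (at t)"
    and V: "uniform_limit {a<..<b} V v sequentially"
    and U: "\<And>t. t \<in> {a<..<b} \<Longrightarrow> (\<lambda>n. U n t) \<longlonglongrightarrow> u t"
    and t: "t \<in> {a<..<b}"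
  shows "(u has_vector_derivative v t) (at t)"
proof -
  let ?J = "{a<..<b}"
  have "\<exists>g. \<forall>x\<in>?J. (\<lambda>n. U n x) \<longlonglongrightarrow> g x \<and> (g has_derivative (\<lambda>h. h *\<^sub>R v x)) (at x within ?J)"
  proof (rule has_derivative_sequence)
    show "(U n has_derivative (\<lambda>h. h *\<^sub>R V n x)) (at x within ?J)" if "x \<in> ?J" for n x
      using der[OF that] has_vector_derivative_at_within unfolding has_vector_derivative_def by blast
    show "\<forall>\<^sub>F n in sequentially. \<forall>x\<in>?J. \<forall>h. norm (h *\<^sub>R V n x - h *\<^sub>R v x) \<le> e * norm h" if "e > 0" for e
      using uniform_limitD[OF V that]
    proof (rule eventually_mono)
      fix n assume *: "\<forall>x\<in>?J. dist (V n x) (v x) < e"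
      have "norm (h *\<^sub>R V n x - h *\<^sub>R v x) \<le> e * norm h" if "x \<in> ?J" for x h
      proof -
        have "norm (V n x - v x) \<le> e" using *[rule_format, OF that] by (simp add: dist_norm)
        then show ?thesis
          by (simp add: mult.commute[of e] mult_left_mono flip: scaleR_diff_right)
      qed
      then show "\<forall>x\<in>?J. \<forall>h. norm (h *\<^sub>R V n x - h *\<^sub>R v x) \<le> e * norm h" by blast
    qed
  qed (use U[OF t] t in auto)
  then obtain g where g: "\<And>x. x \<in> ?J \<Longrightarrow> (\<lambda>n. U n x) \<longlonglongrightarrow> g x"
    "\<And>x. x \<in> ?J \<Longrightarrow> (g has_derivative (\<lambda>h. h *\<^sub>R v x)) (at x within ?J)" by blast
  have "(g has_derivative (\<lambda>h. h *\<^sub>R v t)) (at t)"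
    using g(2)[OF t] at_within_open[OF t open_greaterThanLessThan] by simp
  then have "(g has_vector_derivative v t) (at t)" by (simp add: has_vector_derivative_def)
  moreover have "g x = u x" if "x \<in> ?J" for x using g(1)[OF that] U[OF that] LIMSEQ_unique by blast
  ultimately show ?thesis
    using has_vector_derivative_transform_within_open[OF _ open_greaterThanLessThan t] by blast
qed

text \<open>For \<open>|Im z| \<le> 1\<close> the two inequalities defining the region reduce to \<open>Re z \<le> 0\<close> and
  \<open>Re z \<ge> 0\<close>, so only large imaginary parts remain.\<close>

lemma outside_log_region:
  assumes z: "z \<notin> log_region b b" and b: "b > 0"
  shows "\<bar>Re z\<bar> < b * ln \<bar>Im z\<bar>" "1 < \<bar>Im z\<bar>"
proof -
  have *: "\<not> Re z \<le> min 0 (- b * ln \<bar>Im z\<bar>)" "\<not> Re z \<ge> max 0 (b * ln \<bar>Im z\<bar>)"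
    using z by (auto simp: log_region_def)
  show **: "\<bar>Re z\<bar> < b * ln \<bar>Im z\<bar>" using * by (auto simp: min_def max_def split: if_splits)
  then have "b * ln \<bar>Im z\<bar> > 0" by (rule le_less_trans[OF abs_ge_zero])
  then have pos: "ln \<bar>Im z\<bar> > 0" using b by (simp add: zero_less_mult_iff)
  show "1 < \<bar>Im z\<bar>"
  proof (cases "Im z = 0")
    case False
    then show ?thesis using pos by (simp add: ln_gt_zero_iff)
  qed (use pos in simp)
qed

text \<open>Outside the region a bound on the imaginary part bounds the real part as well, so
  unboundedness must come from the imaginary parts.\<close>

lemma unbounded_outside_log_region:
  assumes unb: "\<not> bounded (\<sigma> - log_region b b)" and b: "b > 0"
  shows "\<exists>z\<in>\<sigma>. \<bar>Im z\<bar> > R \<and> \<bar>Re z\<bar> < b * ln \<bar>Im z\<bar>"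
proof -
  define R' where "R' = max 1 R"
  obtain z where z: "z \<in> \<sigma> - log_region b b" "cmod z > R' + b * ln R'"
    using unb by (auto simp: bounded_iff not_le)
  note out = outside_log_region[of z b]
  have "\<bar>Im z\<bar> > R'"
  proof (rule ccontr)
    assume "\<not> ?thesis"
    then have "ln \<bar>Im z\<bar> \<le> ln R'" using out(2) z b by (intro ln_mono) auto
    then have "b * ln \<bar>Im z\<bar> \<le> b * ln R'" using b by simp
    moreover have "\<bar>Re z\<bar> < b * ln \<bar>Im z\<bar>" using out(1) z b by simp
    ultimately show False using z(2) cmod_le[of z] \<open>\<not> R' < \<bar>Im z\<bar>\<close> by linarith
  qed
  then show ?thesis using out(1) z b by (auto simp: R'_def)
qed

context spectral_calculus
begin

lemma expo_empty: "expo {} t = 0"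
  using calc_const[of 0] by (intro blinfun_eqI) (simp add: expo_def scaleC_op_apply)

lemma expo_norm:
  assumes S: "S \<in> sets borel" "bounded S" and r: "\<And>z. z \<in> S \<Longrightarrow> t * Re z \<le> r"
  shows "norm (expo S t) \<le> 4 * bound * exp r"
  unfolding expo_def
proof (rule calc_norm[OF bounded_borel_exp[OF S]])
  show "cmod (indicator S z * exp (of_real t * z)) \<le> exp r" for z
    using r[of z] by (auto simp: indicator_def norm_exp_eq_Re)
qed

text \<open>On the spectral subspace of a unit disc around \<open>l\<close> the operator differs from multiplication
  by \<open>l\<close> by an integral of a function bounded by \<open>1\<close>.\<close>

lemma gen_lower_bound:
  assumes e: "E (ball l 1) e = e" "norm e = 1"
  shows "norm (gen (ball l 1) e) \<ge> cmod l - 4 * bound"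
proof -
  let ?B = "ball l 1"
  have B: "?B \<in> sets borel" "bounded ?B" by auto
  have b: "bounded_borel (\<lambda>z. indicator ?B z * (z - l))"
    by (intro bounded_borel_cutoff_bounded B continuous_intros)
  have bl: "bounded_borel (\<lambda>_. l)" by (simp add: bounded_borel_def)
  have "\<Phi> (\<lambda>z. indicator ?B z * (z - l)) = \<Phi> (\<lambda>z. indicator ?B z * z - l * indicator ?B z)"
    by (rule arg_cong[of _ _ \<Phi>]) (auto simp: indicator_def)
  also have "\<dots> = gen ?B - (scaleC_op l o\<^sub>L E ?B)"
    unfolding gen_def using calc_diff[OF bounded_borel_id[OF B] bounded_borel_mult[OF bl bounded_borel_indicator[OF B(1)]]]
      calc_mult[OF bl bounded_borel_indicator[OF B(1)]] by (simp add: calc_const calc_indicator B(1))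
  finally have "\<Phi> (\<lambda>z. indicator ?B z * (z - l)) e = gen ?B e - l *\<^sub>C e"
    by (simp add: blinfun.diff_left scaleC_op_apply e)
  moreover have "norm (\<Phi> (\<lambda>z. indicator ?B z * (z - l)) e) \<le> 4 * bound * 1"
  proof -
    have "norm (\<Phi> (\<lambda>z. indicator ?B z * (z - l))) \<le> 4 * bound * 1"
      by (rule calc_norm[OF b]) (auto simp: indicator_def dist_norm norm_minus_commute)
    then show ?thesis using norm_blinfun[of "\<Phi> (\<lambda>z. indicator ?B z * (z - l))" e] e by simp
  qed
  moreover have "norm (l *\<^sub>C e) = cmod l" using e by (simp add: norm_scaleC)
  ultimately show ?thesis using norm_triangle_ineq2[of "l *\<^sub>C e" "gen ?B e"] by (simp add: norm_minus_commute)
qed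

end

context scalar_type_operator
begin

lemma spectral_subspace_nonzero:
  assumes "l \<in> spectrum D A"
  obtains e where "E (ball l 1) e = e" "norm e = 1"
proof -
  have "l \<in> spectral_support E" using st assms by (auto simp: scalar_type_spectral_def)
  then have "E (ball l 1) \<noteq> 0" by (auto simp: spectral_support_def)
  then obtain x where x: "E (ball l 1) x \<noteq> 0" by (metis blinfun_eqI zero_blinfun.rep_eq)
  let ?e = "E (ball l 1) x"
  have "E (ball l 1) ?e = ?e" by (simp add: E_Int)
  then show ?thesis using x by (intro that[of "?e /\<^sub>R norm ?e"]) (auto simp: blinfun.scaleR_right)
qed

text \<open>The weights \<open>|Im l\<^sub>n|\<^bsup>-1/2\<^esup>\<close> lie strictly between two requirements: the series converges for
  all \<open>t\<close> because for large \<open>n\<close> the exponentials contribute at most a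
  constant multiple of \<open>|Im l\<^sub>n|\<^bsup>1/4\<^esup>\<close>, whereas the operator
  \<open>A\<close> contributes a full factor \<open>|Im l\<^sub>n|\<close> to the derivative at \<open>0\<close>.\<close>

lemma nonsmooth_weak_solution:
  assumes unb: "\<And>b. b > 0 \<Longrightarrow> \<not> bounded (spectrum D A - log_region b b)"
  shows "\<exists>y. weak_solution D A y \<and> \<not> y differentiable (at 0)"
proof -
  define P where "P n z \<longleftrightarrow> z \<in> spectrum D A \<and> \<bar>Im z\<bar> > 16 ^ n \<and> \<bar>Re z\<bar> < 1 / real (Suc n) * ln \<bar>Im z\<bar>"
    for n and z :: complex
  have pick: "\<exists>z. P n z \<and> \<bar>Im z\<bar> > R" for n R
    using unbounded_outside_log_region[OF unb, of "1 / real (Suc n)" "max R (16 ^ n)"]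
    by (auto simp: P_def)
  obtain l where l: "\<And>n. P n (l n)" "\<And>n. \<bar>Im (l (Suc n))\<bar> > \<bar>Im (l n)\<bar> + 2"
    using dependent_nat_choice[of P "\<lambda>n z w. \<bar>Im w\<bar> > \<bar>Im z\<bar> + 2"] pick by metis
  define a where "a n = \<bar>Im (l n)\<bar>" for n
  have a16: "a n \<ge> 16 ^ n" for n using l(1)[of n] by (simp add: P_def a_def)
  have a1: "a n \<ge> 1" for n using a16[of n] one_le_power[of "16::real" n] by linarith
  define B where "B n = ball (l n) 1" for n
  have B: "B n \<in> sets borel" "bounded (B n)" for n by (auto simp: B_def)
  \<comment> \<open>A gap larger than \<open>2\<close> between imaginary parts keeps the unit discs disjoint.\<close>
  have gap: "a n > a m + 2" if "m < n" for m n
    using that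
  proof (induction rule: less_Suc_induct)
    case (1 i) then show ?case using l(2)[of i] by (simp add: a_def)
  qed linarith
  have disj: "B m \<inter> B n = {}" if "m \<noteq> n" for m n
  proof -
    have "B m \<inter> B n = {}" if "m < n" for m n
    proof (rule ccontr)
      assume "\<not> ?thesis"
      then obtain z where z: "dist (l m) z < 1" "dist (l n) z < 1" by (auto simp: B_def)
      then have "dist (l m) (l n) < 2" using dist_triangle2[of "l m" "l n" z] by simp
      then have "\<bar>Im (l m) - Im (l n)\<bar> < 2"
        using abs_Im_le_cmod[of "l m - l n"] by (simp add: dist_norm)
      then show False using gap[OF that] by (simp add: a_def)
    qed
    then show ?thesis using that by (metis Int_commute linorder_neqE_nat)
  qed
  have "\<exists>e. E (B n) e = e \<and> norm e = 1" for n
    using spectral_subspace_nonzero[of "l n"] l(1)[of n] unfolding B_def P_def by blast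
  then obtain e where e: "\<And>n. E (B n) (e n) = e n" "\<And>n. norm (e n) = 1" by metis
  define y where "y n t = (1 / sqrt (a n)) *\<^sub>R expo (B n) t (e n)" for n t
  have Ey: "E (B m) (y n t) = (if m = n then y n t else 0)" for m n t
    using disj[of m n] by (simp add: y_def blinfun.scaleR_right E_expo B expo_empty)
  have yD: "y n t \<in> D" "A (y n t) = gen (B n) (y n t)" for n t
    using bounded_part_domain[OF B, of n "y n t"] Ey[of n n t] by auto
  have yder: "(y n has_vector_derivative A (y n t)) (at t)" for n t
  proof -
    have "((\<lambda>t. expo (B n) t (e n)) has_vector_derivative (gen (B n) o\<^sub>L expo (B n) t) (e n)) (at t)"
      by (rule bounded_linear.has_vector_derivative[OF blinfun.bounded_linear_left expo_has_vector_derivative[OF B]])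
    from bounded_linear.has_vector_derivative[OF bounded_linear_scaleR_right this]
    show ?thesis
      unfolding yD(2) unfolding y_def[abs_def] by (simp add: blinfun.scaleR_right)
  qed
  \<comment> \<open>With \<open>a n \<ge> 16 ^ n\<close> the surviving power \<open>a n powr (- 1 / 4)\<close> is at most \<open>(1 / 2) ^ n\<close>.\<close>
  have ybound: "norm (y n t) \<le> 4 * bound * exp T * (1 / 2) ^ n"
    if t: "\<bar>t\<bar> \<le> T" and n: "real (Suc n) \<ge> 4 * T" for n t T
  proof -
    have "norm (expo (B n) t) \<le> 4 * bound * exp (T + ln (a n) / 4)"
    proof (rule expo_norm[OF B])
      fix z assume "z \<in> B n"
      then have "\<bar>Re z\<bar> < \<bar>Re (l n)\<bar> + 1"
        using abs_Re_le_cmod[of "z - l n"] by (auto simp: B_def dist_norm norm_minus_commute)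
      also have "\<dots> \<le> ln (a n) / real (Suc n) + 1" using l(1)[of n] by (simp add: P_def a_def)
      finally have re: "\<bar>Re z\<bar> \<le> ln (a n) / real (Suc n) + 1" by simp
      have lnpos: "ln (a n) \<ge> 0" using a1[of n] by simp
      have "t * Re z \<le> \<bar>t\<bar> * \<bar>Re z\<bar>" by (metis abs_ge_self abs_mult)
      also have "\<dots> \<le> T * (ln (a n) / real (Suc n) + 1)" using t re by (intro mult_mono) auto
      also have "\<dots> = T + (T / real (Suc n)) * ln (a n)" by (simp add: field_simps)
      also have "\<dots> \<le> T + (1 / 4) * ln (a n)"
        using n lnpos by (intro add_left_mono mult_right_mono) (auto simp: field_simps)
      finally show "t * Re z \<le> T + ln (a n) / 4" by simp
    qed
    also have "exp (T + ln (a n) / 4) = exp T * (a n powr (1 / 4))"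
      using a1[of n] by (auto simp: exp_add powr_def)
    finally have 1: "norm (expo (B n) t) \<le> 4 * bound * (exp T * (a n powr (1 / 4)))" .
    have "norm (y n t) \<le> (1 / sqrt (a n)) * norm (expo (B n) t)"
      using norm_blinfun[of "expo (B n) t" "e n"] e(2)[of n] a1[of n]
      by (simp add: y_def divide_right_mono)
    also have "\<dots> \<le> (1 / sqrt (a n)) * (4 * bound * (exp T * (a n powr (1 / 4))))"
      using 1 a1[of n] by (intro mult_left_mono) auto
    also have "\<dots> = 4 * bound * exp T * (a n powr (- 1 / 4))"
    proof -
      have "1 / sqrt (a n) * a n powr (1 / 4) = a n powr (- 1 / 2 + 1 / 4)"
        using a1[of n] unfolding powr_add by (simp add: powr_minus_divide flip: powr_half_sqrt)
      then show ?thesis by (simp add: mult.left_commute mult.assoc)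
    qed
    also have "\<dots> \<le> 4 * bound * exp T * (1 / 2) ^ n"
    proof (rule mult_left_mono)
      have "a n powr (- 1 / 4) \<le> (16 ^ n) powr (- 1 / 4)"
        using a16[of n] by (intro powr_mono2') auto
      also have "\<dots> = (16 powr (- 1 / 4)) ^ n"
        by (simp add: powr_powr mult.commute flip: powr_realpow)
      also have "16 powr (- 1 / 4) = (1 / 2 :: real)"
      proof -
        have "(16::real) powr (- 1 / 4) = (2 powr 4) powr (- 1 / 4)" by simp
        also have "\<dots> = 2 powr (- 1)" by (subst powr_powr) simp
        finally show ?thesis by (simp add: powr_minus_divide)
      qed
      finally show "a n powr (- 1 / 4) \<le> (1 / 2) ^ n" .
    qed (use bound_nonneg in auto)
    finally show ?thesis .
  qed
  define Y where "Y t = (\<Sum>n. y n t)" for t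
  have unif: "uniform_limit {- T<..<T} (\<lambda>n t. \<Sum>i<n. y i t) Y sequentially" for T
    unfolding Y_def
  proof (rule Weierstrass_m_test_ev)
    have "\<forall>\<^sub>F n in sequentially. 4 * T \<le> real n"
      using filterlim_real_sequentially by (auto simp: filterlim_at_top)
    then show "\<forall>\<^sub>F n in sequentially. \<forall>t\<in>{- T<..<T}. norm (y n t) \<le> 4 * bound * exp T * (1 / 2) ^ n"
      by (rule eventually_mono) (auto intro!: ybound)
    show "summable (\<lambda>n. 4 * bound * exp T * (1 / 2) ^ n)"
      by (intro summable_mult summable_geometric) simp
  qed
  have Ylim: "(\<lambda>n. \<Sum>i<n. y i t) \<longlonglongrightarrow> Y t" for t
    by (rule tendsto_uniform_limitI[OF unif[of "\<bar>t\<bar> + 1"]]) auto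
  have "weak_solution D A Y"
    unfolding weak_solution_def
  proof (intro conjI allI impI)
    have cont: "continuous_on {- T<..<T} Y" for T
    proof (rule uniform_limit_theorem[OF _ unif])
      show "\<forall>\<^sub>F n in sequentially. continuous_on {- T<..<T} (\<lambda>t. \<Sum>i<n. y i t)"
        using yder has_vector_derivative_continuous
        by (intro always_eventually allI continuous_on_sum continuous_at_imp_continuous_on) blast
    qed simp
    have "isCont Y t" for t
      by (rule continuous_on_interior[OF cont[of "\<bar>t\<bar> + 1"]]) auto
    then show "continuous_on UNIV Y" by (simp add: continuous_at_imp_continuous_on)
  next
    fix g :: "'a \<Rightarrow>\<^sub>L complex" and t :: real
    assume "g \<in> adjoint_domain D A"
    then obtain h where h: "h \<in> dual_space" "\<And>x. x \<in> D \<Longrightarrow> g (A x) = h x"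
      by (auto simp: adjoint_domain_def)
    let ?T = "\<bar>t\<bar> + 1"
    have "((\<lambda>t. g (Y t)) has_vector_derivative h (Y t)) (at t)"
    proof (rule has_vector_derivative_uniform_limit)
      fix n s
      have "(y i has_vector_derivative A (y i s)) (at s)" for i by (rule yder)
      then have "((\<lambda>s. g (\<Sum>i<n. y i s)) has_vector_derivative g (\<Sum>i<n. A (y i s))) (at s)"
        by (intro bounded_linear.has_vector_derivative[OF blinfun.bounded_linear_right] has_vector_derivative_sum)
      moreover have "g (\<Sum>i<n. A (y i s)) = h (\<Sum>i<n. y i s)"
        by (simp add: blinfun.sum_right h(2) yD(1))
      ultimately show "((\<lambda>s. g (\<Sum>i<n. y i s)) has_vector_derivative h (\<Sum>i<n. y i s)) (at s)" by simp
      show "uniform_limit {- ?T<..<?T} (\<lambda>n s. h (\<Sum>i<n. y i s)) (\<lambda>s. h (Y s)) sequentially"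
        by (rule bounded_linear.uniform_limit[OF blinfun.bounded_linear_right unif])
      show "(\<lambda>n. g (\<Sum>i<n. y i s)) \<longlonglongrightarrow> g (Y s)"
        using Ylim by (intro tendsto_intros)
    qed auto
    then show "((\<lambda>t. g (Y t)) has_vector_derivative adjoint_op D A g (Y t)) (at t)"
      using adjoint_op_eq[OF h] by simp
  qed
  moreover have "\<not> Y differentiable (at 0)"
  proof
    assume "Y differentiable (at 0)"
    then obtain d where d: "(Y has_vector_derivative d) (at 0)"
      using vector_derivative_works by blast
    \<comment> \<open>The projections recover the single terms, so a derivative of the sum bounds those of all terms.\<close>
    have EY: "E (B n) (Y t) = y n t" for n t
    proof -
      have "(\<lambda>N. E (B n) (\<Sum>i<N. y i t)) \<longlonglongrightarrow> E (B n) (Y t)" using Ylim by (intro tendsto_intros)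
      moreover have "\<forall>\<^sub>F N in sequentially. E (B n) (\<Sum>i<N. y i t) = y n t"
        using eventually_gt_at_top[of n]
        by (rule eventually_mono) (simp add: blinfun.sum_right Ey sum.delta)
      then have "(\<lambda>N. E (B n) (\<Sum>i<N. y i t)) \<longlonglongrightarrow> y n t" by (rule tendsto_eventually)
      ultimately show ?thesis using LIMSEQ_unique by blast
    qed
    have "4 ^ n \<le> bound * norm d + 4 * bound" for n
    proof -
      have "(y n has_vector_derivative E (B n) d) (at 0)"
        using bounded_linear.has_vector_derivative[OF blinfun.bounded_linear_right d, of "E (B n)"]
        by (simp add: EY)
      then have "E (B n) d = A (y n 0)" using yder vector_derivative_unique_at by blast
      also have "\<dots> = (1 / sqrt (a n)) *\<^sub>R gen (B n) (e n)"
        by (simp add: yD(2)) (simp add: y_def expo_zero B e blinfun.scaleR_right)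
      finally have eq: "norm (E (B n) d) = norm (gen (B n) (e n)) / sqrt (a n)" using a1[of n] by simp
      have "a n \<le> cmod (l n)" using abs_Im_le_cmod by (simp add: a_def)
      also have "\<dots> \<le> norm (gen (B n) (e n)) + 4 * bound"
        using gen_lower_bound[of "l n" "e n"] e by (simp add: B_def)
      also have "\<dots> = sqrt (a n) * norm (E (B n) d) + 4 * bound" using eq a1[of n] by simp
      also have "\<dots> \<le> sqrt (a n) * (bound * norm d) + sqrt (a n) * (4 * bound)"
      proof -
        have "1 * (4 * bound) \<le> sqrt (a n) * (4 * bound)"
          using a1[of n] bound_nonneg by (intro mult_right_mono) auto
        moreover have "sqrt (a n) * norm (E (B n) d) \<le> sqrt (a n) * (bound * norm d)"
          using norm_E_apply_le[OF B(1)] a1[of n] by (intro mult_left_mono) auto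
        ultimately show ?thesis by simp
      qed
      finally have "sqrt (a n) * sqrt (a n) \<le> sqrt (a n) * (bound * norm d + 4 * bound)"
        using a1[of n] by (simp add: algebra_simps)
      then have "sqrt (a n) \<le> bound * norm d + 4 * bound"
        by (rule mult_left_le_imp_le) (use a1[of n] in simp)
      moreover have "4 ^ n \<le> sqrt (a n)"
      proof (rule real_le_rsqrt)
        have "(4 ^ n)\<^sup>2 = (16 :: real) ^ n" by (simp add: power2_eq_square flip: power_mult_distrib)
        then show "(4 ^ n)\<^sup>2 \<le> a n" using a16[of n] by simp
      qed
      ultimately show ?thesis by linarith
    qed
    moreover obtain n where "bound * norm d + 4 * bound < 4 ^ n"
      using real_arch_pow[of 4] by auto
    ultimately show False by (metis not_le)
  qed
  ultimately show ?thesis by blast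
qed

end

theorem theorem5p1:
  fixes D :: "'a::complex_banach set"
    and A :: "'a \<Rightarrow> 'a"
    and E :: "complex set \<Rightarrow> ('a \<Rightarrow>\<^sub>L 'a)"
  assumes "scalar_type_spectral D A E"
  shows "(\<forall>y. weak_solution D A y \<longrightarrow> strongly_infinitely_differentiable y) \<longleftrightarrow>
         (\<exists>bp>0. \<exists>bm>0. bounded (spectrum D A - log_region bm bp))"
proof -
  interpret scalar_type_operator D A E by unfold_locales (rule assms)
  have "y differentiable (at 0)" if "strongly_infinitely_differentiable y" for y :: "real \<Rightarrow> 'a"
    using that[unfolded strongly_infinitely_differentiable_def, rule_format, of 0] by simp
  then show ?thesis using nonsmooth_weak_solution smooth_if_region by metis
qed

end
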